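(* Let $\rho=2+\sqrt3$. There exist constants $0<m<M$, independent of $n$ and $j$, such that the following hold for all $n\ge1$, with $k=\lfloor n/2\rfloor$ and $0\le j\le n/2$ (writing $X\asymp Y$ for $mY\le X\le MY$): (a) $|p_{j,n}-1|+|u_{j,n}-1|\asymp\rho^{-j}$, and $|u_{k,n}-1|\asymp\rho^{-n/2}$; (b) $|p_{j,n}-p_j^*|+|u_{j,n}-u_j^*|\asymp\rho^{j-n}$; in particular $|p_{0,n}-p_0^*|\asymp\rho^{-n}$; (c) $C-C_n\asymp\rho^{-n}$, where $C=\lim_{n\to\infty}C_n$.
   Context: For $n\ge1$ and $\mathbf{x}=(x_1,\dots,x_n)\in(0,\infty)^n$ let $f_n(\mathbf{x})=\sum_{i=1}^n x_i+\sum_{1\le i\le j\le n}\prod_{k=i}^j \frac1{x_k}$, $A_n=\inf_{\mathbf{x}\in(0,\infty)^n} f_n(\mathbf{x})$, and $C_n=3n-A_n$; the limit $C=\lim_n C_n$ exists. Let $\Phi$ be the partial map of $\mathbb{R}^2$ defined for $p\ne0$ by $\Phi(p,u)=\bigl(p^2(u+1)-1,\ 1/p\bigr)$. For $n\ge1$, the trajectory $T_n$ is the (existing and unique) finite sequence $(p_{j,n},u_{j,n})$, $j=0,\dots,n$, with $(p_{j,n},u_{j,n})=\Phi(p_{j-1,n},u_{j-1,n})$ for $1\le j\le n$, $u_{0,n}=0$, $p_{n,n}=0$, and $p_{j,n}>0$ for $0\le j\le n-1$. For each $j\ge0$ the limit $p_j^*=\lim_{n\to\infty}p_{j,n}$ exists;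 $u_0^*=0$ and $u_j^*=1/p_{j-1}^*=\lim_{n\to\infty}u_{j,n}$ for $j\ge1$. *)

theory Defs
  imports "HOL-Analysis.Analysis"
begin

text \<open>Points of (0,\<infinity>)^n are represented as functions x :: nat \<Rightarrow> real,
  with coordinates x 1, ..., x n (values at other indices are irrelevant).\<close>

definition f_fun :: "nat \<Rightarrow> (nat \<Rightarrow> real) \<Rightarrow> real" where
  "f_fun n x = (\<Sum>i=1..n. x i) + (\<Sum>i=1..n. \<Sum>j=i..n. \<Prod>k=i..j. 1 / x k)"

definition A_const :: "nat \<Rightarrow> real" where
  "A_const n = (INF x \<in> {x. \<forall>i\<in>{1..n}. 0 < x i}. f_fun n x)"

definition C_const :: "nat \<Rightarrow> real" where
  "C_const n = 3 * real n - A_const n"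

definition C_lim :: real where
  "C_lim = lim C_const"

definition Phi :: "real \<times> real \<Rightarrow> real \<times> real" where
  "Phi pu = (fst pu ^ 2 * (snd pu + 1) - 1, 1 / fst pu)"

definition is_traj :: "nat \<Rightarrow> (nat \<Rightarrow> real) \<Rightarrow> (nat \<Rightarrow> real) \<Rightarrow> bool" where
  "is_traj n p u \<longleftrightarrow>
     (\<forall>j\<in>{1..n}. (p j, u j) = Phi (p (j - 1), u (j - 1))) \<and>
     u 0 = 0 \<and> p n = 0 \<and> (\<forall>j<n. 0 < p j)"

text \<open>The unique trajectory; values at indices j > n are normalized to 0
  so that the THE-description picks a unique pair of functions.\<close>
definition traj :: "nat \<Rightarrow> (nat \<Rightarrow> real) \<times> (nat \<Rightarrow> real)" where
  "traj n = (THE pu. is_traj n (fst pu) (snd pu) \<and>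
                 (\<forall>j>n. fst pu j = 0 \<and> snd pu j = 0))"

definition p_traj :: "nat \<Rightarrow> nat \<Rightarrow> real" where
  "p_traj j n = fst (traj n) j"

definition u_traj :: "nat \<Rightarrow> nat \<Rightarrow> real" where
  "u_traj j n = snd (traj n) j"

definition p_star :: "nat \<Rightarrow> real" where
  "p_star j = lim (\<lambda>n. p_traj j n)"

definition u_star :: "nat \<Rightarrow> real" where
  "u_star j = lim (\<lambda>n. u_traj j n)"

definition rho :: real where
  "rho = 2 + sqrt 3"

definition asymp_between :: "real \<Rightarrow> real \<Rightarrow> real \<Rightarrow> real \<Rightarrow> bool" where
  "asymp_between m M X Y \<longleftrightarrow> m * Y \<le> X \<and> X \<le> M * Y"

end

theory Submission
  imports Defs
begin

text \<open>
  Both coordinates of the orbit of \<open>(s, 0)\<close> behave monotonically in \<open>s\<close>, which makes the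
  trajectories unique and \<open>p_traj j n\<close> increasing in \<open>n\<close>; they are symmetric under
  \<open>j \<mapsto> n - j\<close> with the two coordinates swapped. In the variable \<open>v = - ln u\<close> the map becomes
  \<open>4 v\<^sub>i = phi v\<^sub>i\<^sub>+\<^sub>1 - phi (- v\<^sub>i\<^sub>-\<^sub>1)\<close> with \<open>phi 0 = 0\<close> and \<open>phi' 0 = 1\<close>. Hence both \<open>v\<close>
  itself, read from the middle of the trajectory outwards, and the difference of two such solutions
  satisfy \<open>4 D\<^sub>i = a\<^sub>i\<^sub>+\<^sub>1 D\<^sub>i\<^sub>+\<^sub>1 + b\<^sub>i\<^sub>-\<^sub>1 D\<^sub>i\<^sub>-\<^sub>1\<close> with summable deviations of \<open>a\<close>, \<open>b\<close> from 1, and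
  therefore grow like powers of \<open>rho\<close>, the larger root of \<open>4 x = x\<^sup>2 + 1\<close>, up to bounded factors;
  the difference is of order \<open>rho powr (- n / 2)\<close> in the middle, where the shorter solution vanishes.
  In the sums \<open>y\<^sub>j\<close> of the products ending at \<open>j\<close>, the function to be minimised is
  \<open>\<Sum>i. (1 + y\<^sub>i\<^sub>-\<^sub>1) / y\<^sub>i + y\<^sub>i\<close>, convex in \<open>ln y\<close> with the trajectory as its critical point.
  Inserting an entry in the middle of an optimal \<open>y\<close>, or deleting one, changes the
  value by 3 up to the square of the deviation of the middle entries from 1, which is of order
  \<open>rho powr (- n)\<close>.
\<close>

section \<open>Trajectories\<close>

text \<open>The start \<open>s\<close> is the shooting parameter: a trajectory is an orbit whose
  first coordinate vanishes for the first time at step \<open>n\<close>.\<close>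

definition orbit :: "real \<Rightarrow> nat \<Rightarrow> real \<times> real" where
  "orbit s j = (Phi ^^ j) (s, 0)"

lemma orbit_0 [simp]: "orbit s 0 = (s, 0)"
  by (simp add: orbit_def)

lemma orbit_Suc:
  "fst (orbit s (Suc j)) = fst (orbit s j) ^ 2 * (snd (orbit s j) + 1) - 1"
  "snd (orbit s (Suc j)) = 1 / fst (orbit s j)"
  by (simp_all add: orbit_def Phi_def)

text \<open>The second coordinate alone decreases with the starting point, so the monotonicity of the
  first one needs the product of the coordinates, which satisfies
  \<open>p' u' = p u + p - 1 / p\<close>, as additional invariant.\<close>
lemma orbit_mono_aux:
  assumes "s < t" "\<forall>i<n. 0 < fst (orbit s i)" "j \<le> n"
  shows "fst (orbit s j) < fst (orbit t j) \<and>
    fst (orbit s j) * snd (orbit s j) \<le> fst (orbit t j) * snd (orbit t j) \<and>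
    0 \<le> snd (orbit s j) \<and> 0 \<le> snd (orbit t j)"
  using \<open>j \<le> n\<close>
proof (induction j)
  case 0
  then show ?case using \<open>s < t\<close> by simp
next
  case (Suc j)
  obtain p u p' u' where o: "orbit s j = (p, u)" "orbit t j = (p', u')"
    by (metis surj_pair)
  have IH: "p < p'" "p * u \<le> p' * u'" "0 \<le> u" "0 \<le> u'"
    using Suc o by auto
  have p: "0 < p"
    using Suc.prems assms(2) o by (metis Suc_le_lessD fst_conv)
  have "p * (p * u) \<le> p' * (p' * u')"
    using IH p by (intro mult_mono[of p p' "p * u" "p' * u'"]) auto
  moreover have "p^2 < p'^2"
    using IH p by (intro power_strict_mono) auto
  moreover have "1 / p' < 1 / p"
    using IH p by (intro divide_strict_left_mono) auto
  moreover have "(p^2 * (u + 1) - 1) * (1 / p) = p * u + p - 1 / p"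
    using p by (simp add: field_simps power2_eq_square)
  moreover have "(p'^2 * (u' + 1) - 1) * (1 / p') = p' * u' + p' - 1 / p'"
    using p IH by (simp add: field_simps power2_eq_square)
  ultimately show ?case
    using o IH p by (simp add: orbit_Suc) (simp add: algebra_simps power2_eq_square)
qed

lemma orbit_mono:
  assumes "s < t" "\<forall>i<n. 0 < fst (orbit s i)" "j \<le> n"
  shows "fst (orbit s j) < fst (orbit t j)"
  using orbit_mono_aux[OF assms] by blast

text \<open>An upper end for the shooting interval: \<open>p >= 2\<close> and \<open>u >= 0\<close>
  give \<open>p^2 * (u + 1) - 1 >= 2 * p - 1 >= 2\<close>.\<close>

lemma orbit_two: "2 \<le> fst (orbit 2 j) \<and> 0 \<le> snd (orbit 2 j) \<and>
  (0 < j \<longrightarrow> 1 \<le> fst (orbit 2 j) * snd (orbit 2 j))"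
proof (induction j)
  case 0
  then show ?case by simp
next
  case (Suc j)
  obtain p u where o: "orbit 2 j = (p, u)"
    by (metis surj_pair)
  have IH: "2 \<le> p" "0 \<le> u" 
    using Suc o by auto
  have "p^2 * 1 \<le> p^2 * (u + 1)"
    using IH by (intro mult_left_mono) auto
  moreover have "p * 2 \<le> p^2"
    using IH by (simp add: power2_eq_square)
  ultimately have *: "p * 2 - 1 \<le> p^2 * (u + 1) - 1" by linarith
  have "1 \<le> (p^2 * (u + 1) - 1) / p"
    using * IH by (simp add: field_simps)
  then show ?case
    using * IH o by (simp add: orbit_Suc)
qed

text \<open>Only the second coordinate divides by the previous \<open>p\<close>, so the first one
  stays continuous one step longer, up to the index where shooting looks for a zero.\<close>

lemma continuous_orbit:
  assumes "\<forall>s\<in>S. \<forall>i<n. 0 < fst (orbit s i)" "j \<le> n"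
  shows "continuous_on S (\<lambda>s. fst (orbit s (Suc j))) \<and>
    continuous_on S (\<lambda>s. fst (orbit s j)) \<and> continuous_on S (\<lambda>s. snd (orbit s j))"
  using \<open>j \<le> n\<close>
proof (induction j)
  case 0
  show ?case by (auto simp: orbit_Suc intro!: continuous_intros)
next
  case (Suc j)
  moreover have "fst (orbit s j) \<noteq> 0" if "s \<in> S" for s
    using assms(1) Suc.prems that by (metis Suc_le_lessD less_irrefl)
  ultimately have *: "continuous_on S (\<lambda>s. snd (orbit s (Suc j)))"
    by (auto simp: orbit_Suc(2) intro!: continuous_intros)
  then show ?case
    using Suc by (auto simp: orbit_Suc(1)[of _ "Suc j"] simp del: power_Suc intro!: continuous_intros)
qed

section \<open>Existence by shooting, uniqueness, and monotonicity in the length\<close>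

text \<open>Intermediate value theorem, by induction: the solution \<open>s\<close> for
  \<open>n\<close> is sent to -1 at step \<open>Suc n\<close>, the start 2 stays nonnegative, and by
  \<open>orbit_mono\<close> every start above \<open>s\<close> is positive up to step
  \<open>n\<close>.\<close>

lemma exists_shooting: "\<exists>s\<le>2. fst (orbit s n) = 0 \<and> (\<forall>i<n. 0 < fst (orbit s i))"
proof (induction n)
  case 0
  show ?case by (rule exI[of _ 0]) simp
next
  case (Suc n)
  then obtain s where s: "s \<le> 2" "fst (orbit s n) = 0" "\<forall>i<n. 0 < fst (orbit s i)"
    by blast
  have gt: "0 < fst (orbit t i)" if "s < t" "i \<le> n" for t i
  proof -
    have "0 \<le> fst (orbit s i)"
      using s that by (cases "i = n") (simp_all add: less_imp_le)
    then show ?thesis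
      using orbit_mono[OF \<open>s < t\<close> s(3) \<open>i \<le> n\<close>] by linarith
  qed
  \<comment> \<open>At \<open>s\<close> itself the entry at \<open>n\<close> is 0, so on the closed
    interval positivity holds only below \<open>n\<close>; this suffices for continuity at
    \<open>Suc n\<close>.\<close>
  have ge: "0 < fst (orbit t i)" if "s \<le> t" "i < n" for t i
    using gt[of t i] s(3) that by (cases "s = t") auto
  have cont: "continuous_on {s..2} (\<lambda>s. fst (orbit s (Suc n)))"
    using continuous_orbit[of "{s..2}" n n] ge by simp
  have "fst (orbit s (Suc n)) = -1"
    using s by (simp add: orbit_Suc)
  moreover have "0 \<le> fst (orbit 2 (Suc n))"
    using orbit_two[of "Suc n"] by linarith
  ultimately obtain t where t: "s \<le> t" "t \<le> 2" "fst (orbit t (Suc n)) = 0"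
    using IVT'[OF _ _ s(1) cont, of 0] by auto
  have "s \<noteq> t"
    using t(3) \<open>fst (orbit s (Suc n)) = -1\<close> by force
  then have "\<forall>i<Suc n. 0 < fst (orbit t i)"
    using gt t(1) by simp
  then show ?case
    using t by blast
qed

lemma is_traj_orbit:
  assumes "is_traj n p u" "j \<le> n"
  shows "(p j, u j) = orbit (p 0) j"
  using \<open>j \<le> n\<close>
proof (induction j)
  case 0
  then show ?case using assms(1) by (simp add: is_traj_def)
next
  case (Suc j)
  have "(p (Suc j), u (Suc j)) = Phi (p (Suc j - 1), u (Suc j - 1))"
    using assms(1) Suc.prems unfolding is_traj_def
    by (metis Suc_le_eq atLeastAtMost_iff le_add1 plus_1_eq_Suc)
  then show ?case
    using Suc by (simp add: orbit_def)
qed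

lemma is_traj_mono:
  assumes "is_traj n p u" "is_traj m q v" "n \<le> m" "p 0 < q 0" "j \<le> n"
  shows "p j < q j"
proof -
  have "\<forall>i<n. 0 < fst (orbit (p 0) i)"
    using is_traj_orbit[OF assms(1)] assms(1) unfolding is_traj_def
    by (metis fst_conv less_imp_le)
  then have "fst (orbit (p 0) j) < fst (orbit (q 0) j)"
    using orbit_mono assms(4,5) by blast
  then show ?thesis
    using is_traj_orbit[OF assms(1), of j] is_traj_orbit[OF assms(2), of j] assms
    by (metis fst_conv le_trans)
qed

lemma is_traj_unique:
  assumes "is_traj n p u" "is_traj n q v" "j \<le> n"
  shows "p j = q j" "u j = v j"
proof -
  have "p n = 0" "q n = 0"
    using assms by (auto simp: is_traj_def)
  \<comment> \<open>A smaller start would give a smaller value at \<open>n\<close>, but both values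
    there are 0.\<close>
  then have "p 0 = q 0"
    using is_traj_mono[OF assms(1,2), of n] is_traj_mono[OF assms(2,1), of n]
    by (metis le_refl linorder_neqE_linordered_idom less_irrefl)
  then have "(p j, u j) = (q j, v j)"
    using is_traj_orbit assms by metis
  then show "p j = q j" "u j = v j" by auto
qed

lemma is_traj_traj: "is_traj n (\<lambda>j. p_traj j n) (\<lambda>j. u_traj j n)"
proof -
  obtain s where s: "fst (orbit s n) = 0" "\<forall>i<n. 0 < fst (orbit s i)"
    using exists_shooting by blast
  \<comment> \<open>The cutoff beyond \<open>n\<close> matches the normalization in
    \<open>traj\<close>, which makes the pair of functions unique.\<close>
  define p where "p j = (if j \<le> n then fst (orbit s j) else 0)" for j
  define u where "u j = (if j \<le> n then snd (orbit s j) else 0)" for j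
  have "(p j, u j) = Phi (p (j - 1), u (j - 1))" if "j \<in> {1..n}" for j
    using that orbit_Suc[of s "j - 1"] by (auto simp: p_def u_def Phi_def)
  then have tr: "is_traj n p u"
    using s unfolding is_traj_def by (auto simp: p_def u_def)
  let ?P = "\<lambda>pu. is_traj n (fst pu) (snd pu) \<and> (\<forall>j>n. fst pu j = 0 \<and> snd pu j = 0)"
  have "?P (traj n)"
    unfolding traj_def
  proof (rule theI[where a = "(p, u)"])
    show "?P (p, u)"
      using tr by (simp add: p_def u_def)
    fix pu assume pu: "?P pu"
    have "fst pu j = p j \<and> snd pu j = u j" for j
    proof (cases "j \<le> n")
      case True
      then show ?thesis
        using is_traj_unique[OF _ tr] pu by blast
    next
      case False
      then show ?thesis
        using pu by (simp add: p_def u_def)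
    qed
    then show "pu = (p, u)"
      by (auto simp: prod_eq_iff fun_eq_iff)
  qed
  then show ?thesis
    by (simp add: p_traj_def u_traj_def)
qed

lemma traj_simps:
  "u_traj 0 n = 0" "p_traj n n = 0"
  "j < n \<Longrightarrow> 0 < p_traj j n"
  "j < n \<Longrightarrow> p_traj (Suc j) n = p_traj j n ^ 2 * (u_traj j n + 1) - 1"
  "j < n \<Longrightarrow> u_traj (Suc j) n = 1 / p_traj j n"
proof -
  have "(p_traj (Suc j) n, u_traj (Suc j) n) = Phi (p_traj (Suc j - 1) n, u_traj (Suc j - 1) n)"
    if "j < n"
    using that is_traj_traj[of n] unfolding is_traj_def
    by (metis Suc_le_eq atLeastAtMost_iff le_add1 plus_1_eq_Suc)
  then show "j < n \<Longrightarrow> p_traj (Suc j) n = p_traj j n ^ 2 * (u_traj j n + 1) - 1"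
    "j < n \<Longrightarrow> u_traj (Suc j) n = 1 / p_traj j n"
    by (auto simp: Phi_def)
qed (use is_traj_traj[of n] in \<open>auto simp: is_traj_def\<close>)

lemma p_traj_0_le: "p_traj 0 n \<le> 2"
proof -
  obtain s where s: "s \<le> 2" "fst (orbit s n) = 0" "\<forall>i<n. 0 < fst (orbit s i)"
    using exists_shooting by blast
  have "fst (orbit (p_traj 0 n) j) = p_traj j n" if "j \<le> n" for j
    using is_traj_orbit[OF is_traj_traj that] by (metis fst_conv)
  then have "\<not> s < p_traj 0 n"
    using orbit_mono[of s "p_traj 0 n" n n] s by (auto simp: traj_simps)
  then show ?thesis using s by simp
qed

text \<open>At index \<open>n\<close> the shorter trajectory vanishes while the longer one is still
  positive. This excludes equal starts and, by monotonicity of orbits, a lower start of the longer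
  one.\<close>

lemma p_traj_mono:
  assumes "n < m" "j \<le> n"
  shows "p_traj j n < p_traj j m"
proof -
  have "p_traj n n < p_traj n m"
    using assms by (simp add: traj_simps)
  moreover have False if "p_traj 0 m < p_traj 0 n"
  proof -
    have "fst (orbit (p_traj 0 m) n) < fst (orbit (p_traj 0 n) n)"
      using that is_traj_orbit[OF is_traj_traj[of m]] traj_simps(3)[of _ m] assms
      by (intro orbit_mono[where n = n]) (auto, metis fst_conv less_imp_le less_trans)
    then show False
      using \<open>p_traj n n < p_traj n m\<close> is_traj_orbit[OF is_traj_traj] assms
      by (metis fst_conv le_refl less_asym less_imp_le)
  qed
  moreover have False if "p_traj 0 m = p_traj 0 n"
    using that \<open>p_traj n n < p_traj n m\<close> is_traj_orbit[OF is_traj_traj] assms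
    by (metis fst_conv le_refl less_irrefl less_imp_le)
  ultimately have "p_traj 0 n < p_traj 0 m"
    by (metis linorder_neqE_linordered_idom)
  then show ?thesis
    using is_traj_mono[OF is_traj_traj is_traj_traj] assms by simp
qed

text \<open>The swap of the coordinates conjugates \<^const>\<open>Phi\<close> to its inverse.\<close>
lemma traj_reversal:
  assumes "j \<le> n"
  shows "p_traj j n = u_traj (n - j) n"
proof -
  have "(u_traj (n - j) n, p_traj (n - j) n) = Phi (u_traj (n - (j - 1)) n, p_traj (n - (j - 1)) n)"
    if j: "j \<in> {1..n}" for j
  proof -
    have eq: "n - (j - 1) = Suc (n - j)" and "n - j < n"
      using j by auto
    then show ?thesis
      using traj_simps(3,4,5)[of "n - j" n] unfolding eq
      by (simp add: Phi_def power_divide)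
  qed
  moreover have "0 < u_traj (n - j) n" if "j < n" for j
  proof -
    have "n - j = Suc (n - Suc j)" "n - Suc j < n" using that by auto
    then show ?thesis
      using traj_simps(3,5)[of "n - Suc j" n] by simp
  qed
  ultimately have "is_traj n (\<lambda>j. u_traj (n - j) n) (\<lambda>j. p_traj (n - j) n)"
    unfolding is_traj_def by (simp add: traj_simps)
  then show ?thesis
    using is_traj_unique(1)[OF is_traj_traj _ assms] by blast
qed

section \<open>Perturbed linear recurrences\<close>

lemma rho_bounds: "7/2 < rho" "rho < 4"
proof -
  have "3/2 < sqrt 3" "sqrt 3 < 2"
    by (rule real_less_rsqrt real_less_lsqrt; simp add: power2_eq_square)+
  then show "7/2 < rho" "rho < 4"
    by (simp_all add: rho_def)
qed

lemma rho_fixed_point: "rho = 4 - 1 / rho"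
proof -
  have "rho * rho = 4 * rho - 1"
    by (simp add: rho_def algebra_simps)
  then show ?thesis
    using rho_bounds by (simp add: field_simps)
qed

lemma abs_ln_diff_le:
  fixes x y c :: real
  assumes "0 < c" "c \<le> x" "c \<le> y"
  shows "\<bar>ln x - ln y\<bar> \<le> \<bar>x - y\<bar> / c"
proof -
  have *: "ln x - ln y \<le> \<bar>x - y\<bar> / c" if "c \<le> x" "c \<le> y" for x y :: real
  proof -
    have "ln x - ln y \<le> (x - y) / y"
      using that \<open>0 < c\<close> by (intro ln_diff_le) auto
    also have "\<dots> \<le> \<bar>x - y\<bar> / y"
      using that \<open>0 < c\<close> by (intro divide_right_mono) auto
    also have "\<dots> \<le> \<bar>x - y\<bar> / c"
      using that \<open>0 < c\<close> by (intro divide_left_mono) auto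
    finally show ?thesis .
  qed
  then show ?thesis
    using *[OF assms(2,3)] *[OF assms(3,2)] by (simp add: abs_le_iff abs_minus_commute)
qed

text \<open>The ratios \<open>x i = a (i + 1) * D (i + 1) / D i\<close> satisfy \<open>x (i + 1) = 4 - c / x i\<close> with
  \<open>c = a (i + 1) * b i\<close> close to 1. The map \<open>\<lambda>x. 4 - 1 / x\<close> contracts towards \<^const>\<open>rho\<close>, so
  the deviations of the ratios from \<^const>\<open>rho\<close> are summable along with those of the
  coefficients from 1.\<close>
lemma perturbed_growth:
  fixes a b D :: "nat \<Rightarrow> real"
  assumes pos: "\<And>i. 1 \<le> i \<Longrightarrow> i \<le> N \<Longrightarrow> 0 < D i"
    and a: "\<And>i. 1 \<le> i \<Longrightarrow> i \<le> N \<Longrightarrow> \<bar>a i - 1\<bar> \<le> 1/2"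
    and b: "\<And>i. 1 \<le> i \<Longrightarrow> i \<le> N \<Longrightarrow> \<bar>b i - 1\<bar> \<le> 1/2"
    and S: "(\<Sum>i=1..N. \<bar>a i - 1\<bar> + \<bar>b i - 1\<bar>) \<le> S"
    and rec: "\<And>i. 1 \<le> i \<Longrightarrow> Suc (Suc i) \<le> N \<Longrightarrow>
      4 * D (Suc i) = a (Suc (Suc i)) * D (Suc (Suc i)) + b i * D i"
    and start: "2 \<le> N \<Longrightarrow> 2 * D 1 \<le> a 2 * D 2 \<and> a 2 * D 2 \<le> 6 * D 1"
    and i: "1 \<le> i" "i \<le> N"
  shows "\<bar>ln (D i) - ln (D 1) - (real i - 1) * ln rho\<bar> \<le> 4 + 3 * S"
proof -
  define A where "A j = \<bar>a j - 1\<bar>" for j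
  define B where "B j = \<bar>b j - 1\<bar>" for j
  define x where "x j = a (Suc j) * D (Suc j) / D j" for j
  define e where "e j = \<bar>x j - rho\<bar>" for j
  have x_Suc: "x (Suc j) = 4 - a (Suc j) * b j / x j" if "1 \<le> j" "Suc (Suc j) \<le> N" for j
  proof -
    have "0 < a (Suc j)"
      using a[of "Suc j"] that by linarith
    then show ?thesis
      using rec[OF that] pos[of j] pos[of "Suc j"] that
      by (simp add: x_def field_simps)
  qed
  have c_le: "a (Suc j) * b j \<le> 4" if "1 \<le> j" "Suc j \<le> N" for j
  proof -
    have "a (Suc j) \<le> 2" "0 \<le> a (Suc j)" "b j \<le> 2"
      using a[of "Suc j"] b[of j] that by linarith+
    then show ?thesis
      using mult_mono[of "a (Suc j)" 2 "b j" 2] b[of j] that by linarith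
  qed
  \<comment> \<open>The bound 2 reproduces itself: \<open>c <= 4\<close> and \<open>x j >= 2\<close>
    give \<open>4 - c / x j >= 2\<close>.\<close>
  have x_ge: "2 \<le> x j" if "1 \<le> j" "Suc j \<le> N" for j
    using that
  proof (induction j rule: nat_induct_at_least)
    case base
    then have "2 * D 1 \<le> a 2 * D 2" "0 < D 1"
      using start pos[of 1] by auto
    then show ?case
      by (simp add: x_def field_simps numeral_2_eq_2)
  next
    case (Suc j)
    then have "2 \<le> x j" by simp
    then have "a (Suc j) * b j / x j \<le> 2"
      using c_le[of j] Suc by (simp add: field_simps)
    then show ?case
      using x_Suc Suc by simp
  qed
  have e_Suc: "e (Suc j) \<le> e j / 2 + A (Suc j) + B j" if j: "1 \<le> j" "Suc (Suc j) \<le> N" for j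
  proof -
    define c where "c = a (Suc j) * b j"
    have x: "2 \<le> x j" using x_ge j by simp
    have "a (Suc j) * b j - 1 = (a (Suc j) - 1) * b j + (b j - 1)"
      by (simp add: algebra_simps)
    then have "\<bar>c - 1\<bar> \<le> A (Suc j) * \<bar>b j\<bar> + B j"
      unfolding A_def B_def c_def by (metis abs_mult abs_triangle_ineq)
    also have "A (Suc j) * \<bar>b j\<bar> \<le> A (Suc j) * 2"
      using b[of j] j unfolding A_def by (intro mult_left_mono) linarith+
    finally have "\<bar>c - 1\<bar> \<le> A (Suc j) * 2 + B j"
      by simp
    moreover have "0 \<le> B j"
      by (simp add: B_def)
    ultimately have c: "\<bar>c - 1\<bar> / 2 \<le> A (Suc j) + B j"
      by simp
    have "x (Suc j) - rho = 1 / rho - c / x j"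
      using x_Suc[OF j] rho_fixed_point by (simp add: c_def)
    \<comment> \<open>The first term is the contraction of \<open>4 - 1 / x\<close> towards
      \<open>rho\<close>, the second the error made by replacing \<open>c\<close> by 1.\<close>
    also have "\<dots> = (x j - rho) / (rho * x j) + (1 - c) / x j"
      using x rho_bounds by (simp add: field_simps)
    finally have "e (Suc j) \<le> \<bar>x j - rho\<bar> / (rho * x j) + \<bar>c - 1\<bar> / x j"
      using x rho_bounds unfolding e_def
      by (simp add: abs_mult abs_minus_commute order_trans[OF abs_triangle_ineq])
    also have "\<dots> \<le> e j / 2 + \<bar>c - 1\<bar> / 2"
    proof (intro add_mono)
      have "1 * 2 \<le> rho * x j"
        using x rho_bounds by (intro mult_mono) auto
      then show "\<bar>x j - rho\<bar> / (rho * x j) \<le> e j / 2"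
        unfolding e_def by (intro divide_left_mono) auto
      show "\<bar>c - 1\<bar> / x j \<le> \<bar>c - 1\<bar> / 2"
        using x by (intro divide_left_mono) auto
    qed
    finally show ?thesis using c by linarith
  qed
  have step: "\<bar>ln (D (Suc j)) - ln (D j) - ln rho\<bar> \<le> e j / 2 + 2 * A (Suc j)"
    if j: "1 \<le> j" "Suc j \<le> N" for j
  proof -
    have "1/2 \<le> a (Suc j)"
      using a[of "Suc j"] j by linarith
    moreover from this have "ln (x j) = ln (a (Suc j)) + ln (D (Suc j)) - ln (D j)"
      unfolding x_def using pos[of j] pos[of "Suc j"] j by (simp add: ln_div ln_mult)
    moreover have "\<bar>ln (x j) - ln rho\<bar> \<le> e j / 2"
      unfolding e_def using x_ge j rho_bounds by (intro abs_ln_diff_le) auto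
    moreover have "\<bar>ln (a (Suc j))\<bar> \<le> 2 * A (Suc j)"
      using abs_ln_diff_le[of "1/2" "a (Suc j)" 1] \<open>1/2 \<le> a (Suc j)\<close> by (simp add: A_def)
    ultimately show ?thesis
      by linarith
  qed
  \<comment> \<open>Carrying \<open>e j / 2\<close> along makes the induction telescope: a step
    costs \<open>e (Suc j) / 2\<close>, the new carried term is as large, and \<open>e_Suc\<close>
    bounds their sum by \<open>e j / 2\<close> plus coefficient deviations. The constant 4 bounds
    \<open>e 1\<close>.\<close>
  have main: "\<bar>ln (D (Suc j)) - ln (D 1) - real j * ln rho\<bar> + e j / 2
      \<le> 4 + 2 * sum A {1..Suc j} + sum A {1..j} + sum B {1..<j}"
    if "1 \<le> j" "Suc j \<le> N" for j
    using that
  proof (induction j rule: nat_induct_at_least)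
    case base
    then have "2 * D 1 \<le> a 2 * D 2" "a 2 * D 2 \<le> 6 * D 1" "0 < D 1"
      using start pos[of 1] by auto
    then have "2 \<le> x 1" "x 1 \<le> 6"
      by (simp_all add: x_def field_simps numeral_2_eq_2)
    then have "e 1 \<le> 4"
      using rho_bounds by (simp add: e_def)
    moreover have "0 \<le> A 1" "{1..Suc 1} = {1, Suc 1}" by (auto simp: A_def)
    ultimately show ?case
      using step[of 1] base by simp
  next
    case (Suc j)
    have "{1..<Suc j} = insert j {1..<j}" using Suc by auto
    then have "sum B {1..<Suc j} = sum B {1..<j} + B j" by simp
    moreover have "real (Suc j) * ln rho = real j * ln rho + ln rho"
      by (simp add: algebra_simps)
    moreover have "\<bar>ln (D (Suc j)) - ln (D 1) - real j * ln rho\<bar> + e j / 2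
      \<le> 4 + 2 * sum A {1..Suc j} + sum A {1..j} + sum B {1..<j}"
      using Suc by simp
    moreover have "sum A {1..Suc (Suc j)} = sum A {1..Suc j} + A (Suc (Suc j))"
      "sum A {1..Suc j} = sum A {1..j} + A (Suc j)"
      by simp_all
    ultimately show ?case
      using step[of "Suc j"] e_Suc[of j] Suc(1,3) by linarith
  qed
  have nonneg: "0 \<le> A j" "0 \<le> B j" for j
    by (simp_all add: A_def B_def)
  have S': "sum A {1..N} + sum B {1..N} \<le> S"
    using S by (simp add: A_def B_def sum.distrib)
  have SA: "sum A {1..j} \<le> sum A {1..N}" if "j \<le> N" for j
    using that nonneg by (intro sum_mono2) auto
  have SB: "sum B {1..<j} \<le> sum B {1..N}" if "j \<le> N" for j
    using that nonneg by (intro sum_mono2) auto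
  have "0 \<le> sum A {1..N}" "0 \<le> sum B {1..N}"
    using nonneg by (simp_all add: sum_nonneg)
  show ?thesis
  proof (cases "i = 1")
    case True
    then show ?thesis
      using S' \<open>0 \<le> sum A {1..N}\<close> \<open>0 \<le> sum B {1..N}\<close> by simp
  next
    case False
    then obtain j where j: "i = Suc j" "1 \<le> j" "Suc j \<le> N"
      using i by (cases i) auto
    have "0 \<le> e j" by (simp add: e_def)
    then show ?thesis
      using main[OF j(2,3)] SA[of j] SA[of "Suc j"] SB[of j] S' j \<open>0 \<le> sum B {1..N}\<close> by simp
  qed
qed

section \<open>The nonlinearity of the logarithmic recurrence\<close>

text \<open>A rescaled softplus function with derivative \<open>1 + tanh (v / 2)\<close>.\<close>

definition phi :: "real \<Rightarrow> real" where
  "phi v = 2 * ln ((1 + exp v) / 2)"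

lemma phi_0 [simp]: "phi 0 = 0"
  by (simp add: phi_def)

lemma phi_mono: "x \<le> y \<Longrightarrow> phi x \<le> phi y"
  unfolding phi_def by (simp add: ln_mono add_pos_pos)

text \<open>The inequality of arithmetic and geometric means for 1 and \<open>exp v\<close>;
  geometrically, the graph lies above its tangent at 0.\<close>

lemma phi_ge: "v \<le> phi v"
proof -
  have "0 \<le> (exp (v/2) - 1)^2" by simp
  also have "\<dots> = 1 + exp v - 2 * exp (v/2)"
    by (simp add: power2_eq_square algebra_simps flip: exp_add)
  finally have "v / 2 \<le> ln ((1 + exp v) / 2)"
    by (subst ln_ge_iff) (auto simp: add_pos_pos)
  then show ?thesis by (simp add: phi_def)
qed

lemma phi_le: "0 \<le> v \<Longrightarrow> phi v \<le> 2 * v"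
proof -
  assume "0 \<le> v"
  then have "(1 + exp v) / 2 \<le> exp v" by simp
  then have "ln ((1 + exp v) / 2) \<le> ln (exp v)"
    by (subst ln_le_cancel_iff) (auto simp: add_pos_pos)
  then show ?thesis by (simp add: phi_def)
qed

lemma abs_tanh_le: "\<bar>tanh x\<bar> \<le> \<bar>x::real\<bar>"
proof -
  have "tanh y \<le> y" if "0 \<le> y" for y :: real
  proof -
    have "y - tanh y \<ge> 0 - tanh 0"
      using that
      by (intro DERIV_nonneg_imp_nondecreasing[of 0 y "\<lambda>x. x - tanh x"] exI[of _ "(tanh _)^2"])
         (auto intro!: derivative_eq_intros)
    then show ?thesis by simp
  qed
  from this[of "\<bar>x\<bar>"] show ?thesis by simp
qed

text \<open>On the diagonal, \<open>phi_diff\<close> holds for any value; the choice 1 makes the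
  deviation from 1 vanish there.\<close>

definition slope :: "real \<Rightarrow> real \<Rightarrow> real" where
  "slope x y = (if x = y then 1 else (phi x - phi y) / (x - y))"

lemma phi_diff: "phi x - phi y = slope x y * (x - y)"
  by (simp add: slope_def)

text \<open>By the mean value theorem a secant slope is \<open>1 + tanh (z / 2)\<close> with
  \<open>z\<close> between the two points. Hence recurrence coefficients deviate from 1 by at most
  half the size of the entries.\<close>

lemma slope_near_1:
  assumes "\<bar>x\<bar> \<le> c" "\<bar>y\<bar> \<le> c"
  shows "\<bar>slope x y - 1\<bar> \<le> c / 2"
proof -
  have sym: "slope x y = slope y x" for x y
    unfolding slope_def by (metis minus_diff_eq minus_divide_divide)
  have *: "\<bar>slope x y - 1\<bar> \<le> c / 2" if "x < y" "\<bar>x\<bar> \<le> c" "\<bar>y\<bar> \<le> c" for x y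
  proof -
    have "(phi has_real_derivative 2 * (exp z / (1 + exp z))) (at z)" for z
    proof -
      have "2 + exp z * 2 \<noteq> 0" "1 + exp z \<noteq> 0"
        using exp_gt_zero[of z] by linarith+
      then show ?thesis
        unfolding phi_def by (auto intro!: derivative_eq_intros simp: add_pos_pos divide_simps)
    qed
    then obtain z where z: "x < z" "z < y" "phi y - phi x = (y - x) * (2 * (exp z / (1 + exp z)))"
      using MVT2[OF \<open>x < y\<close>, of phi "\<lambda>z. 2 * (exp z / (1 + exp z))"] by blast
    have "slope x y = 2 * (exp z / (1 + exp z))"
      using z(3) \<open>x < y\<close> by (subst sym) (simp add: slope_def)
    also have "\<dots> = 1 + tanh (z / 2)"
    proof -
      have "1 + exp z \<noteq> 0" "1 + exp (-z) \<noteq> 0"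
        by (metis add_pos_pos exp_gt_zero less_irrefl zero_less_one)+
      then show ?thesis
        by (simp add: tanh_real_altdef field_simps flip: exp_add)
    qed
    finally show ?thesis
      using abs_tanh_le[of "z/2"] z that by simp
  qed
  then show ?thesis
    using *[of x y] *[of y x] assms sym[of x y]
    by (cases x y rule: linorder_cases) (simp_all add: slope_def[of y y])
qed

section \<open>Logarithmic coordinates\<close>

text \<open>Meaningful for \<open>1 <= i <= n\<close> only, since
  \<open>u_traj 0 n = 0\<close>.\<close>

definition v_traj :: "nat \<Rightarrow> nat \<Rightarrow> real" where
  "v_traj n i = - ln (u_traj i n)"

lemma p_traj_exp:
  assumes "i < n"
  shows "p_traj i n = exp (v_traj n (Suc i))"
  using traj_simps(3,5)[OF assms] by (simp add: v_traj_def ln_div)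

lemma u_traj_exp:
  assumes "1 \<le> i" "i \<le> n"
  shows "u_traj i n = exp (- v_traj n i)"
  using p_traj_exp[of "i - 1" n] traj_simps(5)[of "i - 1" n] assms
  by (simp add: exp_minus inverse_eq_divide)

text \<open>With the index shift between \<open>p\<close> and \<open>v\<close>, the symmetry of the
  trajectories becomes an odd reflection about \<open>(n + 1) / 2\<close>.\<close>

lemma v_traj_reversal:
  assumes "1 \<le> i" "i \<le> n"
  shows "v_traj n (Suc n - i) = - v_traj n i"
proof -
  have "exp (v_traj n (Suc (n - i))) = exp (- v_traj n i)"
    using traj_reversal[of "n - i" n] p_traj_exp[of "n - i" n] u_traj_exp[of i n] assms by simp
  then show ?thesis
    using assms by (simp add: Suc_diff_le)
qed

lemma v_traj_mono:
  assumes "n < m" "1 \<le> i" "i \<le> n"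
  shows "v_traj n i < v_traj m i"
  using p_traj_mono[of n m "i - 1"] p_traj_exp[of "i - 1"] assms by simp

lemma one_plus_exp_neq_0: "1 + exp (v::real) \<noteq> 0"
  using exp_gt_zero[of v] by linarith

lemma ln_phi: "ln (1 + exp v) = phi v / 2 + ln 2"
  by (simp add: phi_def ln_div one_plus_exp_neq_0 field_simps)

text \<open>The logarithm of \<open>1 + p' = p^2 * (1 + u)\<close>; the two constants
  \<open>ln 2\<close> from \<open>ln_phi\<close> cancel.\<close>

lemma v_traj_rec:
  assumes "1 \<le> i" "Suc (Suc i) \<le> n"
  shows "4 * v_traj n (Suc i) = phi (v_traj n (Suc (Suc i))) - phi (- v_traj n i)"
proof -
  have "1 + exp (v_traj n (Suc (Suc i))) = exp (v_traj n (Suc i)) ^ 2 * (1 + exp (- v_traj n i))"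
    using traj_simps(4)[of i n] p_traj_exp[of i n] p_traj_exp[of "Suc i" n] u_traj_exp[of i n] assms
    by simp
  then have "ln (1 + exp (v_traj n (Suc (Suc i))))
      = ln (exp (v_traj n (Suc i)) ^ 2 * (1 + exp (- v_traj n i)))"
    by simp
  also have "\<dots> = 2 * v_traj n (Suc i) + ln (1 + exp (- v_traj n i))"
    by (subst ln_mult) (auto simp: ln_realpow one_plus_exp_neq_0)
  finally show ?thesis by (simp add: ln_phi)
qed

text \<open>At the boundary \<open>u_traj 0 n = 0\<close> leaves the constant
  \<open>2 * ln 2\<close> in place of the backward term; it cancels in differences of two
  trajectories.\<close>

lemma v_traj_rec_1:
  assumes "2 \<le> n"
  shows "4 * v_traj n 1 = phi (v_traj n 2) + 2 * ln 2"
proof -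
  have "1 + exp (v_traj n 2) = exp (v_traj n 1) ^ 2"
    using traj_simps(4)[of 0 n] traj_simps(1)[of n] p_traj_exp[of 0 n] p_traj_exp[of 1 n] assms
    by (simp add: numeral_2_eq_2)
  then have "ln (1 + exp (v_traj n 2)) = ln (exp (v_traj n 1) ^ 2)"
    by simp
  then show ?thesis by (simp add: ln_phi ln_realpow)
qed

text \<open>The middle entry of the trajectory of odd length \<open>2 * i - 1\<close> vanishes by symmetry.\<close>
lemma v_traj_pos:
  assumes "1 \<le> i" "2 * i \<le> n"
  shows "0 < v_traj n i"
proof -
  have "Suc (2 * i - 1) - i = i" using assms by simp
  then have "v_traj (2 * i - 1) i = 0"
    using v_traj_reversal[of i "2 * i - 1"] assms by simp
  then show ?thesis
    using v_traj_mono[of "2 * i - 1" n i] assms by simp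
qed

lemma ln_2_le_1: "ln 2 \<le> (1::real)"
  using ln_le_minus_one[of 2] by simp

lemma v_traj_1_le:
  assumes "1 \<le> n"
  shows "v_traj n 1 \<le> ln 2"
  using p_traj_0_le[of n] p_traj_exp[of 0 n] assms by (simp add: ln_ge_iff)

text \<open>By the odd reflection the entry after \<open>k\<close> is \<open>- v_traj n k\<close>
  for even \<open>n\<close> and 0 for odd \<open>n\<close>.\<close>

lemma v_traj_middle:
  assumes "2 \<le> n" "k = n div 2"
  shows "v_traj n (Suc k) \<le> 0" "- v_traj n k \<le> v_traj n (Suc k)"
proof -
  have pos: "0 < v_traj n k"
    using v_traj_pos[of k n] assms by auto
  have "v_traj n (Suc k) = - v_traj n k" if "even n"
  proof -
    have "Suc n - k = Suc k" using that assms by auto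
    then show ?thesis
      using v_traj_reversal[of k n] assms by simp
  qed
  moreover have "v_traj n (Suc k) = 0" if "odd n"
  proof -
    have "Suc n - Suc k = Suc k" using that assms by presburger
    then show ?thesis
      using v_traj_reversal[of "Suc k" n] assms by simp
  qed
  ultimately show "v_traj n (Suc k) \<le> 0" "- v_traj n k \<le> v_traj n (Suc k)"
    using pos by (cases "even n"; simp)+
qed

text \<open>If \<open>v\<close> does not increase in the next step, the recurrence with
  \<open>v <= phi v\<close> and \<open>phi v <= 2 * v\<close> gives
  \<open>4 * v' <= 2 * v' + v\<close>. Backward induction from the middle supplies this
  monotonicity.\<close>

lemma v_traj_decay:
  assumes "1 \<le> i" "Suc i \<le> n div 2"
  shows "2 * v_traj n (Suc i) \<le> v_traj n i"
proof -
  define k where "k = n div 2"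
  have halve: "2 * v_traj n (Suc j) \<le> v_traj n j"
    if "1 \<le> j" "Suc j \<le> k" "v_traj n (Suc (Suc j)) \<le> v_traj n (Suc j)" for j
  proof -
    have "4 * v_traj n (Suc j) = phi (v_traj n (Suc (Suc j))) - phi (- v_traj n j)"
      using that by (intro v_traj_rec) (auto simp: k_def)
    also have "\<dots> \<le> phi (v_traj n (Suc j)) + v_traj n j"
      using that phi_ge[of "- v_traj n j"] phi_mono[OF that(3)] by linarith
    also have "0 < v_traj n (Suc j)"
      using that by (intro v_traj_pos) (auto simp: k_def)
    then have "phi (v_traj n (Suc j)) + v_traj n j \<le> 2 * v_traj n (Suc j) + v_traj n j"
      using phi_le[of "v_traj n (Suc j)"] by simp
    finally show ?thesis by simp
  qed
  have "v_traj n (Suc j) \<le> v_traj n j" if "1 \<le> j" "j \<le> k" for j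
    using that(2,1)
  proof (induction rule: inc_induct)
    case base
    then have "2 \<le> n" by (simp add: k_def)
    then show ?case
      using v_traj_middle(1)[of n k] v_traj_pos[of k n] base by (simp add: k_def)
  next
    case (step j)
    then have "2 * v_traj n (Suc j) \<le> v_traj n j"
      by (intro halve) auto
    moreover have "0 < v_traj n (Suc j)"
      using step by (intro v_traj_pos) (auto simp: k_def)
    ultimately show ?case by simp
  qed
  then show ?thesis
    using assms by (intro halve) (auto simp: k_def)
qed

text \<open>A crude geometric decay that makes the deviations of the secant slopes from 1 summable;
  the sharp rate then follows from \<open>perturbed_growth\<close>.\<close>

lemma v_traj_abs_le:
  assumes "1 \<le> i" "i \<le> n" "i \<le> Suc (n div 2)"
  shows "\<bar>v_traj n i\<bar> \<le> 4 * (1/2) ^ i" "\<bar>v_traj n i\<bar> \<le> 1"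
proof -
  \<comment> \<open>Up to the middle the constant is 2; the entry just past it is only bounded by
    its predecessor, which doubles the constant.\<close>
  have *: "v_traj n j \<le> 2 * (1/2) ^ j" if "1 \<le> j" "j \<le> n div 2" for j
    using that
  proof (induction j rule: nat_induct_at_least)
    case base
    then have "1 \<le> n" by linarith
    then show ?case
      using v_traj_1_le[of n] ln_2_le_1 by simp
  next
    case (Suc j)
    then show ?case
      using v_traj_decay[of j n] by simp
  qed
  consider "i \<le> n div 2" | "i = Suc (n div 2)" "n = 1" | "i = Suc (n div 2)" "2 \<le> n"
    using assms by linarith
  then have "\<bar>v_traj n i\<bar> \<le> 4 * (1/2) ^ i \<and> \<bar>v_traj n i\<bar> \<le> 1"
  proof cases
    case 1
    then have "v_traj n i \<le> 2 * (1/2) ^ i" "0 < v_traj n i"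
      using * v_traj_pos assms by auto
    moreover have "(1/2) ^ i \<le> (1/2::real) ^ 1"
      using assms by (intro power_decreasing) auto
    ultimately show ?thesis by simp
  next
    case 2
    then show ?thesis
      using v_traj_reversal[of 1 1] by simp
  next
    case 3
    define k where "k = n div 2"
    have "v_traj n k \<le> 2 * (1/2) ^ k" "\<bar>v_traj n (Suc k)\<bar> \<le> v_traj n k" "1 \<le> k"
      using 3 * v_traj_middle[OF 3(2)] by (auto simp: k_def)
    moreover have "(1/2) ^ k \<le> (1/2::real) ^ 1"
      using \<open>1 \<le> k\<close> by (intro power_decreasing) auto
    ultimately show ?thesis
      using 3 by (simp add: k_def)
  qed
  then show "\<bar>v_traj n i\<bar> \<le> 4 * (1/2) ^ i" "\<bar>v_traj n i\<bar> \<le> 1" by auto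
qed

section \<open>Two-sided estimates by powers of \<open>rho\<close>\<close>

text \<open>For positive \<open>X\<close> this is a bound \<open>K\<close> on the distance of
  \<open>ln X\<close> from \<open>x * ln rho\<close>, so constants add under products and
  shifts.\<close>

definition near :: "real \<Rightarrow> real \<Rightarrow> real \<Rightarrow> bool" where
  "near K X x \<longleftrightarrow> asymp_between (exp (- K)) (exp K) X (rho powr x)"

lemma near_altdef: "near K X x \<longleftrightarrow> exp (x * ln rho - K) \<le> X \<and> X \<le> exp (x * ln rho + K)"
  using rho_bounds
  by (auto simp: near_def asymp_between_def powr_def algebra_simps exp_diff exp_add exp_minus
      inverse_eq_divide)

lemma near_iff: "near K X x \<longleftrightarrow> 0 < X \<and> \<bar>ln X - x * ln rho\<bar> \<le> K"
proof (cases "0 < X")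
  case True
  then have "exp (x * ln rho - K) \<le> X \<longleftrightarrow> x * ln rho - K \<le> ln X"
    "X \<le> exp (x * ln rho + K) \<longleftrightarrow> ln X \<le> x * ln rho + K"
    by (simp add: ln_ge_iff, metis exp_gt_zero ln_exp ln_le_cancel_iff)
  then show ?thesis
    using True by (auto simp: near_altdef abs_le_iff algebra_simps)
next
  case False
  then show ?thesis
    unfolding near_altdef by (meson exp_gt_zero less_le_trans)
qed

lemma near_perturb:
  assumes "near K X x" "0 < c" "X \<le> c * Z" "Z \<le> c * X"
  shows "near (K + ln c) Z x"
proof -
  have "exp (x * ln rho - (K + ln c)) = exp (x * ln rho - K) / c"
    "exp (x * ln rho + (K + ln c)) = c * exp (x * ln rho + K)"
    using \<open>0 < c\<close> by (simp_all add: exp_add exp_diff)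
  moreover have "exp (x * ln rho - K) / c \<le> X / c" "c * X \<le> c * exp (x * ln rho + K)"
    using assms(1,2) by (simp_all add: near_altdef divide_right_mono)
  moreover have "X / c \<le> Z"
    using assms(2,3) by (simp add: field_simps)
  ultimately show ?thesis
    using assms(4) by (simp add: near_altdef)
qed

lemma near_shift:
  assumes "near K X x" "\<bar>x - y\<bar> * ln rho \<le> L"
  shows "near (K + L) X y"
proof -
  have "0 < ln rho" using rho_bounds by simp
  then have "\<bar>x * ln rho - y * ln rho\<bar> \<le> L"
    using assms(2) by (simp add: abs_mult flip: left_diff_distrib)
  then show ?thesis
    using assms(1) by (auto simp: near_iff abs_le_iff)
qed

lemma near_mono: "near K X x \<Longrightarrow> K \<le> L \<Longrightarrow> near L X x"
  by (auto simp: near_iff)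

lemma sum_half_power_le: "(\<Sum>i=1..n. (1/2::real) ^ i) \<le> 1"
proof -
  have "(\<Sum>i=1..n. (1/2::real) ^ i) = 1 - (1/2) ^ n"
    by (induction n) auto
  then show ?thesis by simp
qed

text \<open>Read from the middle outwards, \<^const>\<open>v_traj\<close> grows.\<close>
lemma v_traj_growth:
  fixes n i :: nat
  assumes "1 \<le> i" "i \<le> n div 2"
  shows "\<bar>ln (v_traj n i) - ln (v_traj n (n div 2)) - (real (n div 2) - real i) * ln rho\<bar> \<le> 16"
proof -
  define k where "k = n div 2"
  define z where "z l = v_traj n (Suc k - l)" for l
  \<comment> \<open>Since \<open>phi 0 = 0\<close>, both terms of the recurrence are secant slopes
    at 0 times entries; the reversal turns the backward term \<open>- phi (- v)\<close> into the
    forward one.\<close>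
  define a where "a l = slope 0 (- z l)" for l
  define b where "b l = slope (z l) 0" for l
  have z_le: "\<bar>z l\<bar> \<le> 4 * (1/2) ^ (Suc k - l)" "\<bar>z l\<bar> \<le> 1" if "1 \<le> l" "l \<le> k" for l
    using that v_traj_abs_le[of "Suc k - l" n] by (auto simp: z_def k_def)
  have ab: "\<bar>a l - 1\<bar> \<le> c / 2" "\<bar>b l - 1\<bar> \<le> c / 2" if "\<bar>z l\<bar> \<le> c" for l c
    using that unfolding a_def b_def by (intro slope_near_1; simp)+
  have "\<bar>ln (z (Suc k - i)) - ln (z 1) - (real (Suc k - i) - 1) * ln rho\<bar> \<le> 4 + 3 * 4"
  proof (rule perturbed_growth[where a = a and b = b and N = k])
    show "0 < z l" if "1 \<le> l" "l \<le> k" for l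
      using that unfolding z_def by (intro v_traj_pos) (auto simp: k_def)
    show "\<bar>a l - 1\<bar> \<le> 1/2" "\<bar>b l - 1\<bar> \<le> 1/2" if "1 \<le> l" "l \<le> k" for l
      using ab[OF z_le(2)[OF that]] by auto
    have "(\<Sum>l=1..k. \<bar>a l - 1\<bar> + \<bar>b l - 1\<bar>) \<le> (\<Sum>l=1..k. 4 * (1/2) ^ (k + 1 - l))"
    proof (rule sum_mono)
      fix l assume "l \<in> {1..k}"
      then show "\<bar>a l - 1\<bar> + \<bar>b l - 1\<bar> \<le> 4 * (1/2) ^ (k + 1 - l)"
        using ab[OF z_le(1)[of l]] by simp
    qed
    also have "\<dots> = 4 * (\<Sum>l=1..k. (1/2) ^ l)"
      unfolding sum_distrib_left by (rule sum.atLeastAtMost_rev[symmetric])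
    finally show "(\<Sum>l=1..k. \<bar>a l - 1\<bar> + \<bar>b l - 1\<bar>) \<le> 4"
      using sum_half_power_le[of k] by linarith
    show "4 * z (Suc l) = a (Suc (Suc l)) * z (Suc (Suc l)) + b l * z l"
      if "1 \<le> l" "Suc (Suc l) \<le> k" for l
    proof -
      define j where "j = k - Suc l"
      have j: "1 \<le> j" "Suc k - l = Suc (Suc j)" "Suc k - Suc l = Suc j" "Suc k - Suc (Suc l) = j"
        "Suc (Suc j) \<le> n"
        using that by (auto simp: j_def k_def)
      show ?thesis
        using v_traj_rec[OF j(1,5)] phi_diff[of "v_traj n (Suc (Suc j))" 0] phi_diff[of 0 "- v_traj n j"]
        unfolding a_def b_def z_def j(2,3,4) by simp
    qed
    \<comment> \<open>The entry past the middle contributes \<open>phi (v_traj n (Suc k))\<close>,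
      between \<open>- v_traj n k\<close> and 0, so \<open>a 2 * z 2\<close> lies between 4 and 5
      times \<open>z 1\<close>.\<close>
    show "2 * z 1 \<le> a 2 * z 2 \<and> a 2 * z 2 \<le> 6 * z 1" if "2 \<le> k"
    proof -
      define j where "j = k - 1"
      have j: "1 \<le> j" "Suc k - 2 = j" "k = Suc j" "Suc (Suc j) \<le> n" "2 \<le> n" 
        using that by (auto simp: j_def k_def)
      have "4 * v_traj n k = phi (v_traj n (Suc k)) + a 2 * z 2"
        using v_traj_rec[OF j(1,4)] phi_diff[of 0 "- v_traj n j"]
        unfolding a_def z_def j(2) by (simp add: j(3))
      moreover have "- v_traj n k \<le> phi (v_traj n (Suc k))" "phi (v_traj n (Suc k)) \<le> 0"
        using v_traj_middle[OF j(5) k_def] phi_ge[of "v_traj n (Suc k)"] phi_mono[of _ 0]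
        by fastforce+
      moreover have "0 < v_traj n k"
        using j by (intro v_traj_pos) (auto simp: k_def)
      moreover have "z 1 = v_traj n k" by (simp add: z_def)
      ultimately show ?thesis by linarith
    qed
    show "1 \<le> Suc k - i" "Suc k - i \<le> k"
      using assms by (auto simp: k_def)
  qed
  then show ?thesis
    using assms by (simp add: z_def k_def Suc_diff_le of_nat_diff)
qed

text \<open>Growth from the middle, taken at \<open>i\<close> and at 1, compares
  \<open>v_traj n i\<close> with \<open>v_traj n 1\<close>, which lies between the constants
  \<open>v_traj 2 1\<close> and \<open>ln 2\<close>.\<close>

lemma v_traj_near: "\<exists>K\<ge>0. \<forall>n i. 1 \<le> i \<longrightarrow> i \<le> n div 2 \<longrightarrow> near K (v_traj n i) (- real i)"
proof -
  define K where "K = 32 + \<bar>ln (v_traj 2 1)\<bar> + \<bar>ln (ln 2)\<bar> + ln rho"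
  have "0 < ln rho" using rho_bounds by simp
  have "near K (v_traj n i) (- real i)" if "1 \<le> i" "i \<le> n div 2" for n i
  proof -
    have "2 \<le> n" "0 < v_traj 2 1"
      using that v_traj_pos[of 1 2] by auto
    then have "v_traj 2 1 \<le> v_traj n 1" "v_traj n 1 \<le> ln 2"
      using v_traj_mono[of 2 n 1] v_traj_1_le[of n] by (cases "n = 2"; force)+
    then have "ln (v_traj 2 1) \<le> ln (v_traj n 1)" "ln (v_traj n 1) \<le> ln (ln 2)"
      using \<open>0 < v_traj 2 1\<close> by (intro ln_mono; simp)+
    moreover have "0 < v_traj n i"
      using that by (intro v_traj_pos) auto
    moreover have "\<bar>ln (v_traj n i) - ln (v_traj n (n div 2))
        - (real (n div 2) * ln rho - real i * ln rho)\<bar> \<le> 16"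
      "\<bar>ln (v_traj n 1) - ln (v_traj n (n div 2)) - (real (n div 2) * ln rho - ln rho)\<bar> \<le> 16"
      using v_traj_growth[OF that] v_traj_growth[of 1 n] that by (simp_all add: left_diff_distrib)
    ultimately have "\<bar>ln (v_traj n i) + real i * ln rho\<bar> \<le> K"
      using \<open>0 < ln rho\<close> unfolding K_def by linarith
    then show ?thesis
      using \<open>0 < v_traj n i\<close> by (simp add: near_iff)
  qed
  moreover have "0 \<le> K"
    using \<open>0 < ln rho\<close> by (simp add: K_def)
  ultimately show ?thesis by blast
qed

text \<open>Secant slopes make the difference of two solutions satisfy the perturbed linear
  recurrence exactly. It is read from the left boundary, where
  \<open>4 * D 1 = a 2 * D 2\<close>.\<close>

lemma v_traj_diff_growth:
  assumes "1 \<le> n" "n < m" "1 \<le> i" "i \<le> Suc (n div 2)"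
  shows "\<bar>ln (v_traj m i - v_traj n i) - ln (v_traj m 1 - v_traj n 1) - (real i - 1) * ln rho\<bar> \<le> 16"
proof -
  define k where "k = n div 2"
  define D where "D i = v_traj m i - v_traj n i" for i
  define a where "a i = slope (v_traj m i) (v_traj n i)" for i
  define b where "b i = slope (- v_traj n i) (- v_traj m i)" for i
  have "Suc k \<le> n" using assms by (simp add: k_def)
  have v_le: "\<bar>v_traj N i\<bar> \<le> 4 * (1/2) ^ i" "\<bar>v_traj N i\<bar> \<le> 1"
    if "1 \<le> i" "i \<le> Suc k" "N = n \<or> N = m" for i N
  proof -
    have "n div 2 \<le> N div 2"
      using that \<open>n < m\<close> by (auto intro: div_le_mono)
    then show "\<bar>v_traj N i\<bar> \<le> 4 * (1/2) ^ i" "\<bar>v_traj N i\<bar> \<le> 1"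
      using that v_traj_abs_le[of i N] \<open>Suc k \<le> n\<close> \<open>n < m\<close> by (auto simp: k_def)
  qed
  have ab: "\<bar>a i - 1\<bar> \<le> c / 2" "\<bar>b i - 1\<bar> \<le> c / 2"
    if "\<bar>v_traj n i\<bar> \<le> c" "\<bar>v_traj m i\<bar> \<le> c" for i c
    using that unfolding a_def b_def by (intro slope_near_1; simp)+
  have "\<bar>ln (D i) - ln (D 1) - (real i - 1) * ln rho\<bar> \<le> 4 + 3 * 4"
  proof (rule perturbed_growth[where a = a and b = b and N = "Suc k"])
    show "0 < D l" if "1 \<le> l" "l \<le> Suc k" for l
      using that v_traj_mono[of n m l] assms \<open>Suc k \<le> n\<close> by (simp add: D_def)
    show "\<bar>a l - 1\<bar> \<le> 1/2" "\<bar>b l - 1\<bar> \<le> 1/2" if "1 \<le> l" "l \<le> Suc k" for l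
      using ab[of l 1] v_le[OF that] by auto
    have "(\<Sum>l=1..Suc k. \<bar>a l - 1\<bar> + \<bar>b l - 1\<bar>) \<le> (\<Sum>l=1..Suc k. 4 * (1/2) ^ l)"
    proof (rule sum_mono)
      fix l assume "l \<in> {1..Suc k}"
      then show "\<bar>a l - 1\<bar> + \<bar>b l - 1\<bar> \<le> 4 * (1/2) ^ l"
        using ab[of l "4 * (1/2) ^ l"] v_le(1)[of l] by simp
    qed
    also have "\<dots> = 4 * (\<Sum>l=1..Suc k. (1/2) ^ l)"
      by (rule sum_distrib_left[symmetric])
    finally show "(\<Sum>l=1..Suc k. \<bar>a l - 1\<bar> + \<bar>b l - 1\<bar>) \<le> 4"
      using sum_half_power_le[of "Suc k"] by linarith
    show "4 * D (Suc l) = a (Suc (Suc l)) * D (Suc (Suc l)) + b l * D l"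
      if "1 \<le> l" "Suc (Suc l) \<le> Suc k" for l
      using v_traj_rec[of l n] v_traj_rec[of l m] that assms \<open>Suc k \<le> n\<close>
        phi_diff[of "v_traj m (Suc (Suc l))" "v_traj n (Suc (Suc l))"]
        phi_diff[of "- v_traj n l" "- v_traj m l"]
      by (simp add: a_def b_def D_def)
    show "2 * D 1 \<le> a 2 * D 2 \<and> a 2 * D 2 \<le> 6 * D 1" if "2 \<le> Suc k"
    proof -
      have "4 * D 1 = a 2 * D 2"
        using v_traj_rec_1[of n] v_traj_rec_1[of m] that assms \<open>Suc k \<le> n\<close>
          phi_diff[of "v_traj m 2" "v_traj n 2"]
        by (simp add: a_def D_def)
      moreover have "0 < D 1"
        using v_traj_mono[of n m 1] assms by (simp add: D_def)
      ultimately show ?thesis by linarith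
    qed
    show "1 \<le> i" "i \<le> Suc k"
      using assms by (auto simp: k_def)
  qed
  then show ?thesis by (simp add: D_def)
qed

text \<open>The growth law is anchored at \<open>Suc k\<close> with \<open>k = n div 2\<close>,
  where the shorter solution is nonpositive and the difference has order
  \<open>rho powr (- n / 2)\<close>; going back to \<open>i\<close> gives the exponent
  \<open>i - n\<close>. The gap \<open>n + 2 <= m\<close> keeps \<open>Suc k\<close> in the first
  half of the longer trajectory.\<close>

lemma v_traj_diff_near:
  "\<exists>K\<ge>0. \<forall>n m i. 1 \<le> n \<longrightarrow> n + 2 \<le> m \<longrightarrow> 1 \<le> i \<longrightarrow> i \<le> Suc (n div 2) \<longrightarrow>
    near K (v_traj m i - v_traj n i) (real i - real n)"
proof -
  obtain K where K: "0 \<le> K" "\<And>n i. 1 \<le> i \<Longrightarrow> i \<le> n div 2 \<Longrightarrow> near K (v_traj n i) (- real i)"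
    using v_traj_near by blast
  define L where "L = 32 + K + ln 2 + 3 * ln rho"
  have ln_rho: "0 < ln rho" using rho_bounds by simp
  have "near L (v_traj m i - v_traj n i) (real i - real n)"
    if *: "1 \<le> n" "n + 2 \<le> m" "1 \<le> i" "i \<le> Suc (n div 2)" for n m i
  proof -
    define k where "k = n div 2"
    define D where "D i = v_traj m i - v_traj n i" for i
    have "Suc k \<le> n" "Suc k \<le> m div 2" "n < m"
      using * by (auto simp: k_def)
    have D_pos: "0 < D i" if "1 \<le> i" "i \<le> n" for i
      using v_traj_mono[OF \<open>n < m\<close>] that by (simp add: D_def)
    have lower: "- real (Suc k) * ln rho - K \<le> ln (v_traj m (Suc k))" "0 < v_traj m (Suc k)"
      using K(2)[of "Suc k" m] \<open>Suc k \<le> m div 2\<close> by (auto simp: near_iff)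
    have "v_traj n (Suc k) \<le> 0 \<and> ln (D (Suc k)) \<le> ln 2 + K - real k * ln rho"
    \<comment> \<open>For \<open>n = 1\<close> the index \<open>k\<close> is 0, outside the range of
      \<open>v_traj_near\<close>; there the shorter solution vanishes at 1 by symmetry.\<close>
    proof (cases "n = 1")
      case True
      then have k0: "k = 0" and "v_traj n (Suc k) = 0"
        using v_traj_reversal[of 1 1] by (auto simp: k_def)
      moreover have "near K (v_traj m 1) (- real 1)"
        using K(2)[of 1 m] \<open>Suc k \<le> m div 2\<close> by simp
      ultimately show ?thesis
        using ln_rho ln_gt_zero[of "2::real"] by (simp add: D_def near_iff abs_le_iff del: ln_gt_zero_iff)
    next
      case False
      then have "2 \<le> n" "1 \<le> k" "k \<le> m div 2" using * by (auto simp: k_def)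
      have mid: "v_traj n (Suc k) \<le> 0" "- v_traj n k \<le> v_traj n (Suc k)"
        using v_traj_middle[OF \<open>2 \<le> n\<close> k_def] by auto
      have "v_traj n k < v_traj m k"
        using \<open>Suc k \<le> n\<close> \<open>1 \<le> k\<close> by (intro v_traj_mono[OF \<open>n < m\<close>]) auto
      moreover have "2 * v_traj m (Suc k) \<le> v_traj m k"
        using v_traj_decay[of k m] \<open>1 \<le> k\<close> \<open>Suc k \<le> m div 2\<close> by simp
      ultimately have "D (Suc k) \<le> 2 * v_traj m k"
        using mid lower(2) by (simp add: D_def)
      moreover have v: "0 < v_traj m k" "\<bar>ln (v_traj m k) + real k * ln rho\<bar> \<le> K"
        using K(2)[of k m] \<open>1 \<le> k\<close> \<open>k \<le> m div 2\<close> by (auto simp: near_iff)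
      moreover have "0 < D (Suc k)"
        using D_pos \<open>Suc k \<le> n\<close> by simp
      ultimately have "ln (D (Suc k)) \<le> ln (2 * v_traj m k)"
        by (intro ln_mono) auto
      then have "ln (D (Suc k)) \<le> ln 2 + ln (v_traj m k)"
        using v by (simp add: ln_mult)
      then show ?thesis
        using v mid by linarith
    qed
    moreover from this have "ln (v_traj m (Suc k)) \<le> ln (D (Suc k))"
      using lower by (intro ln_mono) (auto simp: D_def)
    ultimately have "\<bar>ln (D (Suc k)) + real (Suc k) * ln rho\<bar> \<le> K + ln 2 + ln rho"
      using lower ln_rho ln_gt_zero[of "2::real"] by (simp add: abs_le_iff algebra_simps del: ln_gt_zero_iff)
    moreover have "\<bar>ln (D i) - ln (D 1) - (real i - 1) * ln rho\<bar> \<le> 16"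
      "\<bar>ln (D (Suc k)) - ln (D 1) - (real (Suc k) - 1) * ln rho\<bar> \<le> 16"
      unfolding D_def using v_traj_diff_growth[OF \<open>1 \<le> n\<close> \<open>n < m\<close>] *
      by (auto simp: k_def simp del: of_nat_Suc)
    moreover have "real n * ln rho = 2 * (real k * ln rho) \<or> real n * ln rho = 2 * (real k * ln rho) + ln rho"
    proof -
      have "n = 2 * k \<or> n = 2 * k + 1" unfolding k_def by presburger
      then show ?thesis by (auto simp: algebra_simps)
    qed
    ultimately have "\<bar>ln (D i) - (real i - real n) * ln rho\<bar> \<le> L"
      using ln_rho unfolding L_def by (auto simp: abs_le_iff algebra_simps)
    then show ?thesis
      using D_pos[of i] * \<open>Suc k \<le> n\<close> by (simp add: near_iff D_def k_def)
  qed
  moreover have "0 \<le> L"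
    using K(1) ln_rho ln_gt_zero[of "2::real"] by (simp add: L_def)
  ultimately show ?thesis by blast
qed

section \<open>Convergence rates of the trajectories\<close>

lemma abs_exp_diff:
  fixes x y :: real
  assumes "\<bar>x\<bar> \<le> 1" "\<bar>y\<bar> \<le> 1"
  shows "\<bar>x - y\<bar> / 3 \<le> \<bar>exp x - exp y\<bar>" "\<bar>exp x - exp y\<bar> \<le> 3 * \<bar>x - y\<bar>"
proof -
  have *: "(x - y) / 3 \<le> exp x - exp y \<and> exp x - exp y \<le> 3 * (x - y)"
    if "y \<le> x" "\<bar>x\<bar> \<le> 1" "\<bar>y\<bar> \<le> 1" for x y :: real
  proof -
    have e3: "exp 1 \<le> (3::real)" by (rule exp_le)
    have "exp x \<le> exp 1" "exp (-1) \<le> exp y"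
      using that by simp_all
    moreover have "1 / 3 \<le> exp (-1::real)"
      using e3 by (simp add: exp_minus field_simps)
    ultimately have b: "exp x \<le> 3" "1 / 3 \<le> exp y"
      using e3 by linarith+
    have "x - y \<le> exp (x - y) - 1" "1 - exp (y - x) \<le> x - y"
      using exp_ge_add_one_self[of "x - y"] exp_ge_add_one_self[of "y - x"] by linarith+
    with b that have "1 / 3 * (x - y) \<le> exp y * (exp (x - y) - 1)"
      "exp x * (1 - exp (y - x)) \<le> 3 * (x - y)"
      by (intro mult_mono; simp)+
    then show ?thesis
      by (simp add: algebra_simps flip: exp_add)
  qed
  show "\<bar>x - y\<bar> / 3 \<le> \<bar>exp x - exp y\<bar>" "\<bar>exp x - exp y\<bar> \<le> 3 * \<bar>x - y\<bar>"
    using *[of x y] *[of y x] assms by (cases "y \<le> x"; simp add: abs_if)+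
qed

lemma p_traj_0_ge:
  assumes "1 \<le> n"
  shows "1 \<le> p_traj 0 n"
proof -
  have "p_traj 0 1 = 1"
    using p_traj_exp[of 0 1] v_traj_reversal[of 1 1] by simp
  then show ?thesis
    using p_traj_mono[of 1 n 0] assms by (cases "n = 1") auto
qed

text \<open>For \<open>j >= 1\<close> the \<open>u\<close>-term has the order of
  \<open>v_traj n j\<close>, and the \<open>p\<close>-term is governed by the next entry, which is
  no larger in absolute value. For \<open>j = 0\<close> both quantities lie in
  \<open>[1, 2]\<close>.\<close>

lemma traj_minus_1_near:
  "\<exists>K\<ge>0. \<forall>n j. 1 \<le> n \<longrightarrow> j \<le> n div 2 \<longrightarrow>
    near K (\<bar>p_traj j n - 1\<bar> + \<bar>u_traj j n - 1\<bar>) (- real j) \<and> near K \<bar>u_traj j n - 1\<bar> (- real j)"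
proof -
  obtain K where K: "0 \<le> K" "\<And>n i. 1 \<le> i \<Longrightarrow> i \<le> n div 2 \<Longrightarrow> near K (v_traj n i) (- real i)"
    using v_traj_near by blast
  have "near (K + ln 6) (\<bar>p_traj j n - 1\<bar> + \<bar>u_traj j n - 1\<bar>) (- real j)
      \<and> near (K + ln 6) \<bar>u_traj j n - 1\<bar> (- real j)"
    if *: "1 \<le> n" "j \<le> n div 2" for n j
  proof (cases "j = 0")
    case True
    have "near (ln 6) X 0" if "1 \<le> X" "X \<le> 2" for X
      using that by (auto simp: near_iff)
    then show ?thesis
      using near_mono[of "ln 6" _ _ "K + ln 6"] p_traj_0_ge[of n] p_traj_0_le[of n] True * K(1)
      by (simp add: traj_simps)
  next
    case False
    then have j: "1 \<le> j" "j \<le> n" "Suc j \<le> n" "2 \<le> n"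
      using * by auto
    have v: "\<bar>v_traj n j\<bar> \<le> 1" "\<bar>v_traj n (Suc j)\<bar> \<le> 1" "0 < v_traj n j"
      using v_traj_abs_le(2)[of j n] v_traj_abs_le(2)[of "Suc j" n] v_traj_pos[of j n] j * by auto
    have "\<bar>v_traj n (Suc j)\<bar> \<le> v_traj n j"
    proof (cases "j = n div 2")
      case True
      then show ?thesis
        using v_traj_middle[of n j] j v(3) by simp
    next
      case False
      then have "Suc j \<le> n div 2" "2 * Suc j \<le> n" using * by auto
      then show ?thesis
        using v_traj_decay[OF j(1)] v_traj_pos[of "Suc j" n] by force
    qed
    moreover have "\<bar>p_traj j n - 1\<bar> \<le> 3 * \<bar>v_traj n (Suc j)\<bar>"
      using abs_exp_diff(2)[of "v_traj n (Suc j)" 0] v j p_traj_exp[of j n] by simp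
    moreover have u: "v_traj n j / 3 \<le> \<bar>u_traj j n - 1\<bar>" "\<bar>u_traj j n - 1\<bar> \<le> 3 * v_traj n j"
      using abs_exp_diff[of "- v_traj n j" 0] v j u_traj_exp[of j n] by auto
    ultimately have "\<bar>p_traj j n - 1\<bar> + \<bar>u_traj j n - 1\<bar> \<le> 6 * v_traj n j"
      by simp
    then show ?thesis
      using u v(3) abs_ge_zero[of "p_traj j n - 1"]
      by (intro conjI near_perturb[OF K(2)[OF j(1) *(2)]]) argo+
  qed
  moreover have "0 \<le> K + ln 6"
    using K(1) by simp
  ultimately show ?thesis by blast
qed

lemma u_traj_middle_near:
  "\<exists>K\<ge>0. \<forall>n\<ge>1. near K \<bar>u_traj (n div 2) n - 1\<bar> (- real n / 2)"
proof -
  obtain K where K: "0 \<le> K" "\<And>n j. 1 \<le> n \<Longrightarrow> j \<le> n div 2 \<Longrightarrow> near K \<bar>u_traj j n - 1\<bar> (- real j)"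
    using traj_minus_1_near by blast
  have "0 < ln rho" using rho_bounds by simp
  have "near (K + ln rho) \<bar>u_traj (n div 2) n - 1\<bar> (- real n / 2)" if "1 \<le> n" for n
  proof (rule near_shift[OF K(2)])
    define k where "k = n div 2"
    have "n = 2 * k \<or> n = 2 * k + 1"
      unfolding k_def by presburger
    then have "\<bar>- real (n div 2) - - real n / 2\<bar> \<le> 1"
      unfolding k_def[symmetric] by (auto simp: abs_le_iff field_simps)
    then show "\<bar>- real (n div 2) - - real n / 2\<bar> * ln rho \<le> ln rho"
      using \<open>0 < ln rho\<close> by (simp add: mult_le_cancel_right1)
  qed (use that in auto)
  then show ?thesis
    using K(1) \<open>0 < ln rho\<close> by (metis add_nonneg_nonneg less_imp_le)
qed

section \<open>Limits as the length tends to infinity\<close>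

lemma p_star_limit: "(\<lambda>m. p_traj j m) \<longlonglongrightarrow> p_star j"
proof -
  \<comment> \<open>For lengths above \<open>2 * j\<close> the index \<open>Suc j\<close> lies in
    the range of \<open>v_traj_abs_le\<close>, which gives a uniform bound.\<close>
  have "convergent (\<lambda>m. p_traj j (m + Suc (2 * j)))"
  proof (rule Bseq_mono_convergent)
    have "\<bar>p_traj j (m + Suc (2 * j))\<bar> \<le> exp 1" for m
    proof -
      have "Suc j \<le> Suc ((m + Suc (2 * j)) div 2)" by presburger
      then have "\<bar>v_traj (m + Suc (2 * j)) (Suc j)\<bar> \<le> 1"
        by (intro v_traj_abs_le) auto
      then show ?thesis
        using p_traj_exp[of j "m + Suc (2 * j)"] by simp
    qed
    then show "Bseq (\<lambda>m. p_traj j (m + Suc (2 * j)))"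
      by (intro BseqI'[of _ "exp 1"]) simp
    show "\<forall>m n. m \<le> n \<longrightarrow> p_traj j (m + Suc (2 * j)) \<le> p_traj j (n + Suc (2 * j))"
    proof (intro allI impI)
      fix m n :: nat assume "m \<le> n"
      then show "p_traj j (m + Suc (2 * j)) \<le> p_traj j (n + Suc (2 * j))"
        using p_traj_mono[of "m + Suc (2 * j)" "n + Suc (2 * j)" j] by (cases "m = n") auto
    qed
  qed
  then have "convergent (\<lambda>m. p_traj j m)"
    using convergent_ignore_initial_segment by blast
  then show ?thesis
    by (simp add: p_star_def convergent_LIMSEQ_iff)
qed

lemma u_star_limit: "(\<lambda>m. u_traj j m) \<longlonglongrightarrow> u_star j"
proof -
  have "convergent (\<lambda>m. u_traj j m)"
  proof (cases j)
    case 0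
    then show ?thesis by (simp add: traj_simps convergent_const)
  next
    case (Suc i)
    \<comment> \<open>Monotonicity in the length keeps the limit above a positive value, so
      reciprocals converge.\<close>
    have "p_traj i (Suc i) \<le> p_star i"
      by (rule LIMSEQ_le_const[OF p_star_limit])
        (metis p_traj_mono le_less lessI order_refl less_imp_le)
    then have "p_star i \<noteq> 0"
      using traj_simps(3)[of i "Suc i"] by simp
    then have "(\<lambda>m. 1 / p_traj i m) \<longlonglongrightarrow> 1 / p_star i"
      by (intro tendsto_intros p_star_limit)
    moreover have "\<forall>\<^sub>F m in sequentially. 1 / p_traj i m = u_traj j m"
      using eventually_gt_at_top[of i] by eventually_elim (simp add: Suc traj_simps)
    ultimately show ?thesis
      using convergentI Lim_transform_eventually by blast
  qed
  then show ?thesis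
    by (simp add: u_star_def convergent_LIMSEQ_iff)
qed

text \<open>The bounds against length \<open>m\<close> are uniform in \<open>m >= n + 2\<close> and
  pass to the limit. For \<open>u\<close> an upper bound is enough, as \<open>p\<close> alone yields
  the lower bound of the sum.\<close>

lemma traj_minus_star_near:
  "\<exists>K\<ge>0. \<forall>n j. 1 \<le> n \<longrightarrow> j \<le> n div 2 \<longrightarrow>
    near K \<bar>p_traj j n - p_star j\<bar> (real j - real n) \<and>
    near K (\<bar>p_traj j n - p_star j\<bar> + \<bar>u_traj j n - u_star j\<bar>) (real j - real n)"
proof -
  obtain K where K: "0 \<le> K" "\<And>n m i. 1 \<le> n \<Longrightarrow> n + 2 \<le> m \<Longrightarrow> 1 \<le> i \<Longrightarrow> i \<le> Suc (n div 2) \<Longrightarrow>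
    near K (v_traj m i - v_traj n i) (real i - real n)"
    using v_traj_diff_near by blast
  define L where "L = K + ln rho + ln 3"
  have ln_rho: "0 < ln rho" using rho_bounds by simp
  have p: "near L \<bar>p_traj j n - p_traj j m\<bar> (real j - real n)" and
    u: "\<bar>u_traj j n - u_traj j m\<bar> \<le> exp ((real j - real n) * ln rho + L)"
    if *: "1 \<le> n" "j \<le> n div 2" "n + 2 \<le> m" for n j m
  proof -
    have v_le: "\<bar>v_traj N i\<bar> \<le> 1" if "N = n \<or> N = m" "1 \<le> i" "i \<le> Suc j" for i N
      using that * div_le_mono[of n m 2] by (intro v_traj_abs_le) auto
    have "near K (v_traj m (Suc j) - v_traj n (Suc j)) (real (Suc j) - real n)"
      using K(2)[of n m "Suc j"] * by simp
    moreover have "j < n" "j < m" "n < m" using * by auto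
    ultimately have "near (K + ln 3) \<bar>p_traj j n - p_traj j m\<bar> (real (Suc j) - real n)"
      using abs_exp_diff[of "v_traj n (Suc j)" "v_traj m (Suc j)"] v_le
        p_traj_exp[of j] v_traj_mono[of n m "Suc j"]
      by (intro near_perturb[of K "v_traj m (Suc j) - v_traj n (Suc j)"]) auto
    then have "near (K + ln 3 + ln rho) \<bar>p_traj j n - p_traj j m\<bar> (real j - real n)"
      by (rule near_shift) simp
    then show "near L \<bar>p_traj j n - p_traj j m\<bar> (real j - real n)"
      by (simp add: L_def algebra_simps)
    show "\<bar>u_traj j n - u_traj j m\<bar> \<le> exp ((real j - real n) * ln rho + L)"
    proof (cases "j = 0")
      case True
      then show ?thesis by (simp add: traj_simps)
    next
      case False
      then have "near K (v_traj m j - v_traj n j) (real j - real n)"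
        using K(2)[of n m j] * by simp
      moreover have "j \<le> n" "j \<le> m" "n < m" using * by auto
      ultimately have "near (K + ln 3) \<bar>u_traj j n - u_traj j m\<bar> (real j - real n)"
        using abs_exp_diff[of "- v_traj n j" "- v_traj m j"] v_le False
          u_traj_exp[of j] v_traj_mono[of n m j]
        by (intro near_perturb[of K "v_traj m j - v_traj n j"]) auto
      then have "near L \<bar>u_traj j n - u_traj j m\<bar> (real j - real n)"
        by (rule near_mono) (use ln_rho in \<open>simp add: L_def\<close>)
      then show ?thesis by (simp add: near_altdef)
    qed
  qed
  have "near L \<bar>p_traj j n - p_star j\<bar> (real j - real n) \<and>
    near (L + ln 2) (\<bar>p_traj j n - p_star j\<bar> + \<bar>u_traj j n - u_star j\<bar>) (real j - real n)"
    if *: "1 \<le> n" "j \<le> n div 2" for n j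
  proof -
    define E where "E = exp ((real j - real n) * ln rho + L)"
    have limp: "(\<lambda>m. \<bar>p_traj j n - p_traj j m\<bar>) \<longlonglongrightarrow> \<bar>p_traj j n - p_star j\<bar>"
      by (intro tendsto_intros p_star_limit)
    have limu: "(\<lambda>m. \<bar>u_traj j n - u_traj j m\<bar>) \<longlonglongrightarrow> \<bar>u_traj j n - u_star j\<bar>"
      by (intro tendsto_intros u_star_limit)
    have "exp ((real j - real n) * ln rho - L) \<le> \<bar>p_traj j n - p_star j\<bar>"
      using p[OF *] by (intro LIMSEQ_le_const[OF limp] exI[of _ "n + 2"]) (simp add: near_altdef)
    moreover have "\<bar>p_traj j n - p_star j\<bar> \<le> E"
      using p[OF *] unfolding E_def
      by (intro LIMSEQ_le_const2[OF limp] exI[of _ "n + 2"]) (simp add: near_altdef)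
    moreover have "\<bar>u_traj j n - u_star j\<bar> \<le> E"
      using u[OF *] unfolding E_def by (intro LIMSEQ_le_const2[OF limu] exI[of _ "n + 2"]) simp
    moreover have "exp ((real j - real n) * ln rho + (L + ln 2)) = 2 * E"
      unfolding E_def add.assoc[symmetric] by (subst exp_add) simp
    moreover have "exp ((real j - real n) * ln rho - (L + ln 2)) \<le> exp ((real j - real n) * ln rho - L)"
      by simp
    ultimately show ?thesis
      unfolding near_altdef E_def[symmetric] by linarith
  qed
  moreover have "L \<le> L + ln 2" "0 \<le> L + ln 2"
    using K(1) ln_rho by (simp_all add: L_def)
  ultimately show ?thesis
    using near_mono by blast
qed

section \<open>The minimisation problem\<close>

text \<open>The objective after the substitution \<open>x i = (1 + y (i - 1)) / y i\<close>, with
  boundary value \<open>y 0 = 0\<close>.\<close>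

definition F_fun :: "nat \<Rightarrow> (nat \<Rightarrow> real) \<Rightarrow> real" where
  "F_fun n y = (\<Sum>i=1..n. (1 + y (i - 1)) / y i + y i)"

fun ending_sums :: "(nat \<Rightarrow> real) \<Rightarrow> nat \<Rightarrow> real" where
  "ending_sums x 0 = 0"
| "ending_sums x (Suc i) = (1 + ending_sums x i) / x (Suc i)"

lemma ending_sums_eq: "ending_sums x j = (\<Sum>i=1..j. \<Prod>k=i..j. 1 / x k)"
proof (induction j)
  case 0
  then show ?case by simp
next
  case (Suc j)
  have "(\<Sum>i=1..Suc j. \<Prod>k=i..Suc j. 1 / x k) = (\<Sum>i=1..j. (\<Prod>k=i..j. 1 / x k) / x (Suc j)) + 1 / x (Suc j)"
    by simp
  also have "\<dots> = ending_sums x (Suc j)"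
    by (simp add: Suc.IH add_divide_distrib sum_divide_distrib)
  finally show ?case by simp
qed

lemma f_fun_eq: "f_fun n x = (\<Sum>i=1..n. x i + ending_sums x i)"
proof (induction n)
  case 0
  then show ?case by (simp add: f_fun_def)
next
  case (Suc n)
  have "(\<Sum>i=1..Suc n. \<Sum>j=i..Suc n. \<Prod>k=i..j. 1 / x k)
      = (\<Sum>i=1..Suc n. (\<Sum>j=i..n. \<Prod>k=i..j. 1 / x k) + (\<Prod>k=i..Suc n. 1 / x k))"
    by (intro sum.cong) auto
  also have "\<dots> = (\<Sum>i=1..n. \<Sum>j=i..n. \<Prod>k=i..j. 1 / x k) + ending_sums x (Suc n)"
    by (simp add: sum.distrib ending_sums_eq)
  finally show ?case
    using Suc.IH by (simp add: f_fun_def)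
qed

lemma f_fun_F_fun:
  assumes "\<forall>i\<in>{1..n}. 0 < x i"
  shows "f_fun n x = F_fun n (ending_sums x)" "\<forall>i\<in>{1..n}. 0 < ending_sums x i"
proof -
  have pos: "0 \<le> ending_sums x i \<and> (1 \<le> i \<longrightarrow> 0 < ending_sums x i)" if "i \<le> n" for i
    using that
  proof (induction i)
    case (Suc i)
    then have "0 < x (Suc i)" using assms by simp
    then show ?case using Suc by (simp add: add_pos_nonneg)
  qed simp
  then show "\<forall>i\<in>{1..n}. 0 < ending_sums x i" by simp
  show "f_fun n x = F_fun n (ending_sums x)"
    unfolding f_fun_eq F_fun_def
  proof (intro sum.cong refl)
    fix i assume i: "i \<in> {1..n}"
    then obtain j where j: "i = Suc j" by (cases i) auto
    have "0 < x i" "0 < 1 + ending_sums x j"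
      using assms i j pos[of j] by auto
    then show "x i + ending_sums x i = (1 + ending_sums x (i - 1)) / ending_sums x i + ending_sums x i"
      by (simp add: j)
  qed
qed

text \<open>The inverse substitution; with \<open>f_fun_F_fun\<close> it identifies the two
  minimisation problems.\<close>

lemma F_fun_f_fun:
  assumes "\<forall>i\<in>{1..n}. 0 < y i" "y 0 = 0"
  defines "x \<equiv> \<lambda>i. (1 + y (i - 1)) / y i"
  shows "f_fun n x = F_fun n y" "\<forall>i\<in>{1..n}. 0 < x i"
proof -
  have nonneg: "0 \<le> y i" if "i \<le> n" for i
    using assms that by (cases "i = 0") (auto simp: less_imp_le)
  have y: "ending_sums x i = y i" if "i \<le> n" for i
    using that
  proof (induction i)
    case (Suc i)
    then have "0 < 1 + y i" "ending_sums x i = y i"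
      using nonneg[of i] by auto
    then show ?case by (simp add: x_def)
  qed (simp add: assms)
  show "f_fun n x = F_fun n y"
    unfolding f_fun_eq F_fun_def
  proof (intro sum.cong refl)
    fix i assume "i \<in> {1..n}"
    then show "x i + ending_sums x i = (1 + y (i - 1)) / y i + y i"
      using y[of i] by (simp add: x_def)
  qed
  show "\<forall>i\<in>{1..n}. 0 < x i"
  proof
    fix i assume "i \<in> {1..n}"
    then show "0 < x i"
      using assms(1) nonneg[of "i - 1"] by (auto simp: x_def intro!: divide_pos_pos add_pos_nonneg)
  qed
qed

lemma u_traj_pos:
  assumes "1 \<le> i" "i \<le> n"
  shows "0 < u_traj i n"
  using u_traj_exp[OF assms] by simp

text \<open>In the coordinates \<open>ln (y i)\<close> the function is convex and the trajectory is its critical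
  point; the convexity enters through \<open>1 + ln r \<le> r\<close>.\<close>
lemma F_fun_minimal:
  assumes y: "\<forall>i\<in>{1..n}. 0 < y i" "y 0 = 0"
  shows "F_fun n (\<lambda>i. u_traj i n) \<le> F_fun n y"
proof -
  define u where "u i = u_traj i n" for i
  define p where "p i = p_traj i n" for i
  \<comment> \<open>At index 0 both \<open>y\<close> and \<open>u\<close> vanish; the value 1 keeps
    \<open>y i = r i * u i\<close> and a positive ratio.\<close>
  define r where "r i = (if i = 0 then 1 else y i / u i)" for i
  have u0: "u 0 = 0" and pn: "p n = 0"
    by (simp_all add: u_def p_def traj_simps)
  have u_pos: "0 < u i" if "1 \<le> i" "i \<le> n" for i
    using u_traj_pos that by (simp add: u_def)
  have r_pos: "0 < r i" if "i \<le> n" for i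
    using y u_pos[of i] that by (cases "i = 0") (auto simp: r_def)
  have y_r: "y i = r i * u i" if "i \<le> n" for i
    using y u0 u_pos[of i] that by (cases "i = 0") (auto simp: r_def)
  \<comment> \<open>At the trajectory the derivative of \<open>F_fun N\<close> in
    \<open>ln (y N)\<close> is \<open>- u N * p N\<close>, which accounts for the boundary term;
    \<open>p n = 0\<close> removes it at the end.\<close>
  have "F_fun N u - ln (r N) * (u N * p N) \<le> F_fun N y" if "N \<le> n" for N
    using that
  proof (induction N)
    case 0
    then show ?case by (simp add: F_fun_def u0)
  next
    case (Suc i)
    define s where "s = ln (r i)"
    define t where "t = ln (r (Suc i))"
    have pi: "0 < p i" and uS: "u (Suc i) = 1 / p i" and pS: "p (Suc i) = p i ^ 2 * (u i + 1) - 1"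
      using traj_simps(3-5)[of i n] Suc.prems by (simp_all add: u_def p_def)
    have rp: "0 < r i" "0 < r (Suc i)"
      using r_pos Suc.prems by auto
    have ui: "0 \<le> u i"
      using u0 u_pos[of i] Suc.prems by (cases "i = 0") (auto simp: less_imp_le)
    have "1 - t \<le> 1 / r (Suc i)"
      using ln_le_minus_one[of "1 / r (Suc i)"] rp by (simp add: ln_div t_def)
    then have 1: "p i * (1 - t) \<le> p i * (1 / r (Suc i))"
      using pi by (intro mult_left_mono) auto
    have "1 + s - t \<le> r i / r (Suc i)"
      using ln_le_minus_one[of "r i / r (Suc i)"] rp by (simp add: ln_div s_def t_def)
    then have 2: "p i * u i * (1 + s - t) \<le> p i * u i * (r i / r (Suc i))"
      using pi ui by (intro mult_left_mono) auto
    have "1 + t \<le> r (Suc i)"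
      using ln_le_minus_one[of "r (Suc i)"] rp by (simp add: t_def)
    then have 3: "1 / p i * (1 + t) \<le> 1 / p i * r (Suc i)"
      using pi by (intro mult_left_mono) auto
    have F_Suc: "F_fun (Suc i) g = F_fun i g + ((1 + g i) / g (Suc i) + g (Suc i))" for g
      by (simp add: F_fun_def)
    have "F_fun (Suc i) y
        = F_fun i y + (p i * (1 / r (Suc i)) + p i * u i * (r i / r (Suc i)) + 1 / p i * r (Suc i))"
      unfolding F_Suc using pi rp Suc.prems by (simp add: y_r uS field_simps)
    moreover have "F_fun (Suc i) u = F_fun i u + (p i + p i * u i + 1 / p i)"
      unfolding F_Suc using pi by (simp add: uS field_simps)
    moreover have "t * (u (Suc i) * p (Suc i)) = p i * u i * t + p i * t - 1 / p i * t"
      using pi by (simp add: uS pS field_simps power2_eq_square)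
    moreover have "p i * (1 - t) = p i - p i * t"
      "p i * u i * (1 + s - t) = p i * u i + s * (u i * p i) - p i * u i * t"
      "1 / p i * (1 + t) = 1 / p i + 1 / p i * t"
      by (simp_all add: algebra_simps add_divide_distrib)
    moreover have "F_fun i u - s * (u i * p i) \<le> F_fun i y"
      using Suc by (simp add: s_def)
    ultimately show ?case
      using 1 2 3 unfolding t_def[symmetric] by linarith
  qed
  from this[of n] show ?thesis
    by (simp add: pn u_def[abs_def])
qed

lemma A_const_eq: "A_const n = F_fun n (\<lambda>i. u_traj i n)"
  unfolding A_const_def
proof (rule cInf_eq_minimum)
  have "\<forall>i\<in>{1..n}. 0 < u_traj i n" "u_traj 0 n = 0"
    using u_traj_pos by (auto simp: traj_simps)
  from F_fun_f_fun[OF this]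
  show "F_fun n (\<lambda>i. u_traj i n) \<in> f_fun n ` {x. \<forall>i\<in>{1..n}. 0 < x i}"
    by (intro image_eqI[where x = "\<lambda>i. (1 + u_traj (i - 1) n) / u_traj i n"]) simp_all
  show "F_fun n (\<lambda>i. u_traj i n) \<le> z" if "z \<in> f_fun n ` {x. \<forall>i\<in>{1..n}. 0 < x i}" for z
    using that f_fun_F_fun[of n] F_fun_minimal[of n] by auto
qed

section \<open>Comparing consecutive lengths by insertion and deletion\<close>

text \<open>Two places change: the new entry brings its own summand, and in the following summand
  the predecessor \<open>y k\<close> becomes \<open>w\<close>.\<close>

lemma F_fun_insert:
  assumes "k < n"
  shows "F_fun (Suc n) (\<lambda>i. if i \<le> k then y i else if i = Suc k then w else y (i - 1))
    = F_fun n y + ((1 + y k) / w + w + (w - y k) / y (Suc k))"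
proof -
  define z where "z i = (if i \<le> k then y i else if i = Suc k then w else y (i - 1))" for i
  have F_Suc: "F_fun (Suc i) g = F_fun i g + ((1 + g i) / g (Suc i) + g (Suc i))" for i g
    by (simp add: F_fun_def)
  have z: "z k = y k" "z (Suc k) = w" "z (Suc (Suc k)) = y (Suc k)"
    by (auto simp: z_def)
  have Fk: "F_fun k z = F_fun k y"
    unfolding F_fun_def by (intro sum.cong) (auto simp: z_def)
  have "F_fun (Suc n) z = F_fun n y + ((1 + y k) / w + w + (w - y k) / y (Suc k))"
    using Suc_leI[OF assms]
  proof (induction n rule: dec_induct)
    case base
    show ?case by (simp add: F_Suc z Fk add_divide_distrib diff_divide_distrib)
  next
    case (step n)
    then have "z (Suc n) = y n" "z (Suc (Suc n)) = y (Suc n)"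
      by (auto simp: z_def)
    then show ?case
      using step.IH F_Suc[of "Suc n" z] F_Suc[of n y] by simp
  qed
  then show ?thesis by (simp add: z_def[abs_def])
qed

lemma A_const_insert:
  assumes "k < n" "0 < w"
  shows "A_const (Suc n) \<le> A_const n
    + ((1 + u_traj k n) / w + w + (w - u_traj k n) * p_traj k n)"
proof -
  have "A_const (Suc n) \<le> F_fun (Suc n)
      (\<lambda>i. if i \<le> k then u_traj i n else if i = Suc k then w else u_traj (i - 1) n)"
    unfolding A_const_eq using assms u_traj_pos
    by (intro F_fun_minimal) (auto simp: traj_simps)
  also have "\<dots> = A_const n + ((1 + u_traj k n) / w + w + (w - u_traj k n) * p_traj k n)"
    using F_fun_insert[OF assms(1), of "\<lambda>i. u_traj i n" w] traj_simps(3,5)[OF assms(1)]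
    by (simp add: A_const_eq)
  finally show ?thesis .
qed

lemma A_const_delete:
  fixes n k :: nat
  defines "z \<equiv> \<lambda>i. u_traj i (Suc n)"
  assumes "k < n"
  shows "A_const n + ((1 + z k) / z (Suc k) + z (Suc k) + (z (Suc k) - z k) * p_traj (Suc k) (Suc n))
    \<le> A_const (Suc n)"
proof -
  define y where "y i = (if i \<le> k then z i else z (Suc i))" for i
  have "A_const n \<le> F_fun n y"
    unfolding A_const_eq using assms u_traj_pos
    by (intro F_fun_minimal) (auto simp: traj_simps y_def)
  moreover have "(\<lambda>i. if i \<le> k then y i else if i = Suc k then z (Suc k) else y (i - 1)) = z"
    by (auto simp: y_def fun_eq_iff)
  with F_fun_insert[OF assms(2), of y "z (Suc k)"] have
    "A_const (Suc n) = F_fun n y + ((1 + y k) / z (Suc k) + z (Suc k) + (z (Suc k) - y k) / y (Suc k))"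
    by (simp add: A_const_eq z_def)
  moreover have "y k = z k" "1 / y (Suc k) = p_traj (Suc k) (Suc n)"
    using traj_simps(3,5)[of "Suc k" "Suc n"] assms by (auto simp: y_def z_def)
  ultimately show ?thesis
    by (metis add_le_cancel_right divide_inverse inverse_eq_divide)
qed

lemma p_traj_middle:
  assumes "1 \<le> n" "k = n div 2"
  shows "even n \<Longrightarrow> p_traj k n = u_traj k n" "odd n \<Longrightarrow> p_traj k n = 1"
    "odd n \<Longrightarrow> u_traj (Suc k) n = 1" "u_traj k n < 1"
proof -
  show "p_traj k n = u_traj k n" if "even n"
    using traj_reversal[of k n] that assms by (auto elim: evenE)
  have *: "v_traj n (Suc k) = 0" if "odd n"
  proof -
    have "Suc n - Suc k = Suc k" "Suc k \<le> n" using that assms by presburger+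
    then show ?thesis
      using v_traj_reversal[of "Suc k" n] by simp
  qed
  have "k < n" using assms by simp
  then show "odd n \<Longrightarrow> p_traj k n = 1" "odd n \<Longrightarrow> u_traj (Suc k) n = 1"
    using * p_traj_exp[of k n] u_traj_exp[of "Suc k" n] by auto
  show "u_traj k n < 1"
    using v_traj_pos[of k n] u_traj_exp[of k n] assms by (cases "k = 0") (auto simp: traj_simps)
qed

lemma C_const_diff_lower:
  assumes "1 \<le> n"
  shows "(1 - u_traj (n div 2) n)\<^sup>2 / 8 \<le> C_const (Suc n) - C_const n"
proof -
  define k where "k = n div 2"
  define e where "e = u_traj k n"
  have "k < n" using assms by (simp add: k_def)
  have e: "0 \<le> e" "e < 1"
    using p_traj_middle(4)[OF assms k_def] u_traj_pos[of k n] \<open>k < n\<close>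
    by (cases "k = 0"; force simp: e_def traj_simps)+
  have "A_const (Suc n) \<le> A_const n + (3 - (1 - e)\<^sup>2 / 8)"
  proof (cases "even n")
    case True
    have "A_const (Suc n) \<le> A_const n + ((1 + e) / 1 + 1 + (1 - e) * e)"
      using A_const_insert[OF \<open>k < n\<close>, of 1] p_traj_middle(1)[OF assms k_def True] by (simp add: e_def)
    also have "(1 + e) / 1 + 1 + (1 - e) * e = 3 - (1 - e)\<^sup>2"
      by (simp add: algebra_simps power2_eq_square)
    also have "\<dots> \<le> 3 - (1 - e)\<^sup>2 / 8"
      by simp
    finally show ?thesis by simp
  next
    case False
    \<comment> \<open>For odd \<open>n\<close> the choice 1 would cost exactly 3. The minimiser of
      \<open>(1 + e) / w + 2 * w\<close> is the square root of \<open>(1 + e) / 2\<close>; this is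
      its linearization at \<open>e = 1\<close>, and \<open>(1 - e)\<^sup>2 / 8\<close> is the
      second-order gain.\<close>
    define w where "w = (3 + e) / 4"
    have "0 < w" using e by (simp add: w_def)
    have "A_const (Suc n) \<le> A_const n + ((1 + e) / w + w + (w - e))"
      using A_const_insert[OF \<open>k < n\<close> \<open>0 < w\<close>] p_traj_middle(2)[OF assms k_def False]
      by (simp add: e_def)
    moreover have "(1 + e) / w \<le> 3 - (1 - e)\<^sup>2 / 8 - (2 * w - e)"
    proof -
      have "(3 - (1 - e)\<^sup>2 / 8 - (2 * w - e)) * w - (1 + e) = (1 - e) ^ 3 / 32"
        by (simp add: w_def field_simps power2_eq_square power3_eq_cube)
      moreover have "0 \<le> (1 - e) ^ 3 / 32" using e by simp
      ultimately have "1 + e \<le> (3 - (1 - e)\<^sup>2 / 8 - (2 * w - e)) * w" by linarith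
      then show ?thesis
        using \<open>0 < w\<close> by (simp add: pos_divide_le_eq)
    qed
    ultimately show ?thesis by linarith
  qed
  then show ?thesis
    by (simp add: C_const_def e_def k_def)
qed

text \<open>The entry deleted from the optimum for \<open>Suc n\<close> is the central one, equal to
  1 by symmetry.\<close>

lemma C_const_diff_upper_even:
  assumes "1 \<le> n" "even n"
  shows "C_const (Suc n) - C_const n \<le> (1 - u_traj (Suc n div 2) (Suc n))\<^sup>2"
proof -
  define k where "k = Suc n div 2"
  define e where "e = u_traj k (Suc n)"
  have k: "k < n" "Suc n - Suc k = k" "odd (Suc n)" "Suc k \<le> Suc n"
    using assms unfolding k_def by presburger+
  have "p_traj (Suc k) (Suc n) = e"
    using traj_reversal[of "Suc k" "Suc n"] k by (simp add: e_def)
  moreover have "u_traj (Suc k) (Suc n) = 1"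
    using p_traj_middle(3)[of "Suc n" k] k k_def by simp
  ultimately have "A_const n + ((1 + e) / 1 + 1 + (1 - e) * e) \<le> A_const (Suc n)"
    using A_const_delete[OF k(1)] by (simp add: e_def)
  moreover have "(1 + e) / 1 + 1 + (1 - e) * e = 3 - (1 - e)\<^sup>2"
    by (simp add: algebra_simps power2_eq_square)
  ultimately show ?thesis
    by (simp add: C_const_def e_def k_def)
qed

text \<open>The deleted entry sits at half of the even length \<open>Suc n\<close>, where both
  coordinates agree.\<close>

lemma C_const_diff_upper_odd:
  assumes "odd n"
  shows "C_const (Suc n) - C_const n
    \<le> 2 * ((1 - u_traj (n div 2) (Suc n)) * (1 - u_traj (Suc n div 2) (Suc n)))"
proof -
  define k where "k = n div 2"
  have k: "k < n" "Suc n div 2 = Suc k" "even (Suc n)" "1 \<le> n"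
    using assms unfolding k_def by presburger+
  define h where "h = u_traj k (Suc n)"
  define e where "e = u_traj (Suc k) (Suc n)"
  have e: "0 < e" "e < 1"
    using u_traj_pos[of "Suc k" "Suc n"] p_traj_middle(4)[of "Suc n" "Suc k"] k by (auto simp: e_def)
  have h: "0 \<le> h"
    using u_traj_pos[of k "Suc n"] k by (cases "k = 0") (auto simp: h_def traj_simps less_imp_le)
  have "p_traj (Suc k) (Suc n) = e"
    using p_traj_middle(1)[of "Suc n" "Suc k"] k by (simp add: e_def)
  then have "A_const n + ((1 + h) / e + e + (e - h) * e) \<le> A_const (Suc n)"
    using A_const_delete[OF k(1)] by (simp add: e_def h_def)
  \<comment> \<open>Here \<open>1 / e\<close> is replaced by its tangent \<open>2 - e\<close> at 1,
    which makes the cost polynomial.\<close>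
  moreover have "(1 + h) * (2 - e) \<le> (1 + h) / e"
  proof -
    have "(2 - e) * e \<le> 1"
      using zero_le_power2[of "1 - e"] by (simp add: power2_eq_square algebra_simps)
    then have "(1 + h) * ((2 - e) * e) \<le> (1 + h) * 1"
      using h by (intro mult_left_mono) auto
    then show ?thesis
      using e by (simp add: pos_le_divide_eq mult.assoc)
  qed
  moreover have "(1 + h) * (2 - e) + e + (e - h) * e = 3 - 2 * ((1 - h) * (1 - e)) + (1 - e)\<^sup>2"
    by (simp add: algebra_simps power2_eq_square)
  moreover have "0 \<le> (1 - e)\<^sup>2" by simp
  ultimately have "A_const n + 3 - 2 * ((1 - h) * (1 - e)) \<le> A_const (Suc n)"
    by linarith
  then show ?thesis
    unfolding k(2) k_def[symmetric] by (simp add: C_const_def e_def h_def)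
qed

lemma near_mult:
  assumes "near K X x" "near L Y y"
  shows "near (K + L) (X * Y) (x + y)"
proof -
  have "ln (X * Y) - (x + y) * ln rho = (ln X - x * ln rho) + (ln Y - y * ln rho)"
    using assms by (simp add: near_iff ln_mult algebra_simps)
  then show ?thesis
    using assms unfolding near_iff by (smt (verit) zero_less_mult_iff)
qed

text \<open>Insertion bounds the increment from below and deletion from above, both by products of
  two middle deviations. For odd \<open>n\<close> their exponents \<open>k\<close> and
  \<open>Suc k\<close> add up to \<open>n\<close>.\<close>

lemma C_const_diff_near:
  "\<exists>K\<ge>0. \<forall>n\<ge>1. near K (C_const (Suc n) - C_const n) (- real n)"
proof -
  obtain K where K: "0 \<le> K" "\<And>n. 1 \<le> n \<Longrightarrow> near K \<bar>u_traj (n div 2) n - 1\<bar> (- real n / 2)"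
    using u_traj_middle_near by blast
  obtain L where L: "0 \<le> L" "\<And>n j. 1 \<le> n \<Longrightarrow> j \<le> n div 2 \<Longrightarrow> near L \<bar>u_traj j n - 1\<bar> (- real j)"
    using traj_minus_1_near by blast
  have sq: "near (2 * K) ((1 - u_traj (n div 2) n)\<^sup>2) (- real n)" if "1 \<le> n" for n
    using near_mult[OF K(2)[OF that] K(2)[OF that]] by (simp add: power2_eq_square abs_mult_self_eq algebra_simps)
  have ln_rho: "0 < ln rho" using rho_bounds by simp
  define M where "M = 2 * K + 2 * L + ln 8"
  have "near M (C_const (Suc n) - C_const n) (- real n)" if n: "1 \<le> n" for n
  proof -
    define E where "E = exp (- real n * ln rho)"
    have "0 < E" by (simp add: E_def)
    have split: "exp (- real n * ln rho + c) = E * exp c" for c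
      unfolding E_def by (rule exp_add)
    have "- M = - (2 * K) + - (2 * L) - ln 8"
      by (simp add: M_def)
    then have expM: "exp M = exp (2 * K) * exp (2 * L) * 8"
      "exp (- M) = exp (- (2 * K)) * exp (- (2 * L)) / 8"
      by (simp_all only: M_def exp_diff exp_add) simp_all
    have ge1: "1 \<le> exp (2 * K)" "1 \<le> exp (2 * L)" "exp (- (2 * L)) \<le> 1"
      using K(1) L(1) by auto
    have "E * exp (- (2 * K)) \<le> (1 - u_traj (n div 2) n)\<^sup>2"
      using sq[OF n] split[of "- (2 * K)"] by (simp add: near_altdef)
    moreover have "exp (- (2 * K)) * exp (- (2 * L)) \<le> exp (- (2 * K))"
      using ge1 by (simp add: mult_left_le)
    then have "E * (exp (- (2 * K)) * exp (- (2 * L))) \<le> E * exp (- (2 * K))"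
      using \<open>0 < E\<close> by simp
    ultimately have lower: "E * exp (- M) \<le> C_const (Suc n) - C_const n"
      using C_const_diff_lower[OF n] by (simp add: expM)
    have "C_const (Suc n) - C_const n \<le> E * (2 * (exp (2 * K) * exp (2 * L)))"
    proof (cases "even n")
      case True
      have "(1 - u_traj (Suc n div 2) (Suc n))\<^sup>2 \<le> exp (- real (Suc n) * ln rho + 2 * K)"
        using sq[of "Suc n"] by (simp add: near_altdef)
      also have "\<dots> \<le> exp (- real n * ln rho + 2 * K)"
        using ln_rho by (simp add: algebra_simps)
      also have "\<dots> = E * exp (2 * K)" by (rule split)
      also have "\<dots> \<le> E * (2 * (exp (2 * K) * exp (2 * L)))"
      proof (rule mult_left_mono)
        have "exp (2 * K) * 1 \<le> exp (2 * K) * exp (2 * L)"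
          using ge1 by (intro mult_left_mono) auto
        then show "exp (2 * K) \<le> 2 * (exp (2 * K) * exp (2 * L))"
          using exp_gt_zero[of "2 * K"] by linarith
      qed (use \<open>0 < E\<close> in simp)
      finally show ?thesis
        using C_const_diff_upper_even[OF n True] by simp
    next
      case False
      define k where "k = n div 2"
      have k: "n = 2 * k + 1" "Suc n div 2 = Suc k"
        using False unfolding k_def by presburger+
      have "near (L + L) (\<bar>u_traj k (Suc n) - 1\<bar> * \<bar>u_traj (Suc k) (Suc n) - 1\<bar>) (- real k + - real (Suc k))"
        using k by (intro near_mult L(2)) auto
      moreover have "- real k + - real (Suc k) = - real n"
        by (simp add: k)
      ultimately have "\<bar>u_traj k (Suc n) - 1\<bar> * \<bar>u_traj (Suc k) (Suc n) - 1\<bar> \<le> exp (- real n * ln rho + 2 * L)"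
        by (simp only: near_altdef) simp
      also have "\<dots> = E * exp (2 * L)" by (rule split)
      also have "\<dots> \<le> E * (exp (2 * K) * exp (2 * L))"
        using \<open>0 < E\<close> ge1 by simp
      finally have "\<bar>u_traj k (Suc n) - 1\<bar> * \<bar>u_traj (Suc k) (Suc n) - 1\<bar>
          \<le> E * (exp (2 * K) * exp (2 * L))" .
      moreover have "(1 - u_traj k (Suc n)) * (1 - u_traj (Suc k) (Suc n))
          \<le> \<bar>u_traj k (Suc n) - 1\<bar> * \<bar>u_traj (Suc k) (Suc n) - 1\<bar>"
        using abs_ge_self[of "(1 - u_traj k (Suc n)) * (1 - u_traj (Suc k) (Suc n))"]
        by (simp add: abs_mult abs_minus_commute)
      ultimately show ?thesis
        using C_const_diff_upper_odd[OF False] unfolding k(2) k_def[symmetric] by simp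
    qed
    also have "\<dots> \<le> E * exp M"
      using \<open>0 < E\<close> by (simp add: expM)
    finally have "C_const (Suc n) - C_const n \<le> E * exp M" .
    then show ?thesis
      using lower split[of M] split[of "- M"] by (simp add: near_altdef)
  qed
  moreover have "0 \<le> M" using K(1) L(1) by (simp add: M_def)
  ultimately show ?thesis by blast
qed

text \<open>The upper bound on the increments makes \<open>C_const n + 2 * exp K / rho ^ n\<close> decrease, since
  \<open>1 / rho \<le> 1 / 2\<close>.\<close>
lemma C_lim_near: "\<exists>K\<ge>0. \<forall>n\<ge>1. near K (C_lim - C_const n) (- real n)"
proof -
  obtain K where K: "0 \<le> K" "\<And>n. 1 \<le> n \<Longrightarrow> near K (C_const (Suc n) - C_const n) (- real n)"
    using C_const_diff_near by blast
  define E where "E n = exp (- real n * ln rho)" for n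
  have diff: "E n * exp (- K) \<le> C_const (Suc n) - C_const n"
    "C_const (Suc n) - C_const n \<le> E n * exp K" if "1 \<le> n" for n
    using K(2)[OF that] by (simp_all add: near_altdef E_def flip: exp_add)
  have E_pos: "0 < E n" for n by (simp add: E_def)
  have E_Suc: "E (Suc n) \<le> E n / 2" for n
  proof -
    have "- real (Suc n) * ln rho = - real n * ln rho - ln rho"
      by (simp add: algebra_simps)
    then have "E (Suc n) = E n / rho"
      unfolding E_def using rho_bounds by (simp only: exp_diff) simp
    also have "\<dots> \<le> E n / 2"
      using rho_bounds E_pos[of n] by (intro divide_left_mono) auto
    finally show ?thesis .
  qed
  have inc: "C_const n \<le> C_const m" if "n \<le> m" "1 \<le> n" for n m
    using that
  proof (induction rule: dec_induct)
    case (step m)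
    then have "0 \<le> E m * exp (- K)" "E m * exp (- K) \<le> C_const (Suc m) - C_const m"
      using diff(1)[of m] E_pos[of m] by auto
    then show ?case using step by simp
  qed simp
  have dec: "C_const m + 2 * exp K * E m \<le> C_const n + 2 * exp K * E n" if "n \<le> m" "1 \<le> n" for n m
    using that
  proof (induction rule: dec_induct)
    case (step m)
    have "2 * exp K * E (Suc m) \<le> 2 * exp K * (E m / 2)"
      by (intro mult_left_mono E_Suc) auto
    then have "2 * exp K * E (Suc m) \<le> E m * exp K" "2 * exp K * E m = 2 * (E m * exp K)"
      by simp_all
    moreover have "C_const (Suc m) - C_const m \<le> E m * exp K"
      using step diff(2)[of m] by simp
    moreover have "C_const m + 2 * exp K * E m \<le> C_const n + 2 * exp K * E n"
      using step by simp
    ultimately show ?case by linarith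
  qed simp
  have upper: "C_const m \<le> C_const n + 2 * exp K * E n" if "n \<le> m" "1 \<le> n" for n m
  proof -
    have "0 \<le> 2 * exp K * E m" using E_pos[of m] by simp
    then show ?thesis using dec[OF that] by linarith
  qed
  have "convergent (\<lambda>n. C_const (n + 1))"
  proof (rule Bseq_mono_convergent)
    have "\<bar>C_const (n + 1)\<bar> \<le> \<bar>C_const 1\<bar> + 2 * exp K * E 1" for n
      using upper[of 1 "n + 1"] inc[of 1 "n + 1"] E_pos[of 1]
        mult_pos_pos[of "2 * exp K" "E 1"] by simp
    then show "Bseq (\<lambda>n. C_const (n + 1))"
      by (intro BseqI') simp
    show "\<forall>m n. m \<le> n \<longrightarrow> C_const (m + 1) \<le> C_const (n + 1)"
      using inc by simp
  qed
  then have "convergent C_const"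
    using convergent_ignore_initial_segment by blast
  then have lim: "C_const \<longlonglongrightarrow> C_lim"
    by (simp add: C_lim_def convergent_LIMSEQ_iff)
  have "near (K + ln 2) (C_lim - C_const n) (- real n)" if "1 \<le> n" for n
  proof -
    have "C_lim \<le> C_const n + 2 * exp K * E n"
      using upper that by (intro LIMSEQ_le_const2[OF lim]) auto
    \<comment> \<open>The first increment alone gives the lower bound, as the later ones are
      nonnegative.\<close>
    moreover have "C_const (Suc n) \<le> C_lim"
      using inc by (intro LIMSEQ_le_const[OF lim] exI[of _ "Suc n"]) simp
    moreover have "exp (- real n * ln rho + (K + ln 2)) = 2 * exp K * E n"
      by (simp add: E_def exp_add exp_diff exp_minus divide_inverse)
    moreover have "exp (- real n * ln rho - (K + ln 2)) \<le> E n * exp (- K)"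
      by (simp add: E_def flip: exp_add)
    ultimately show ?thesis
      using diff(1)[OF that] unfolding near_altdef by linarith
  qed
  moreover have "0 \<le> K + ln 2" using K(1) by simp
  ultimately show ?thesis by blast
qed

theorem theorem2:
  shows "\<exists>m M. 0 < m \<and> m < M \<and>
    (\<forall>n\<ge>1.
       asymp_between m M \<bar>u_traj (n div 2) n - 1\<bar> (rho powr (- real n / 2)) \<and>
       asymp_between m M \<bar>p_traj 0 n - p_star 0\<bar> (rho powr (- real n)) \<and>
       asymp_between m M (C_lim - C_const n) (rho powr (- real n)) \<and>
       (\<forall>j. real j \<le> real n / 2 \<longrightarrow>
          asymp_between m M (\<bar>p_traj j n - 1\<bar> + \<bar>u_traj j n - 1\<bar>) (rho powr (- real j)) \<and>
          asymp_between m M (\<bar>p_traj j n - p_star j\<bar> + \<bar>u_traj j n - u_star j\<bar>)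
                            (rho powr (real j - real n))))"
proof -
  obtain K1 where K1: "0 \<le> K1" "\<And>n. 1 \<le> n \<Longrightarrow> near K1 \<bar>u_traj (n div 2) n - 1\<bar> (- real n / 2)"
    using u_traj_middle_near by blast
  obtain K2 where K2: "0 \<le> K2" "\<And>n j. 1 \<le> n \<Longrightarrow> j \<le> n div 2 \<Longrightarrow>
      near K2 (\<bar>p_traj j n - 1\<bar> + \<bar>u_traj j n - 1\<bar>) (- real j)"
    using traj_minus_1_near by blast
  obtain K3 where K3: "0 \<le> K3" "\<And>n j. 1 \<le> n \<Longrightarrow> j \<le> n div 2 \<Longrightarrow>
      near K3 \<bar>p_traj j n - p_star j\<bar> (real j - real n) \<and>
      near K3 (\<bar>p_traj j n - p_star j\<bar> + \<bar>u_traj j n - u_star j\<bar>) (real j - real n)"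
    using traj_minus_star_near by blast
  obtain K4 where K4: "0 \<le> K4" "\<And>n. 1 \<le> n \<Longrightarrow> near K4 (C_lim - C_const n) (- real n)"
    using C_lim_near by blast
  \<comment> \<open>The summand 1 makes \<open>K\<close> positive, so that the two constants
    differ.\<close>
  define K where "K = K1 + K2 + K3 + K4 + 1"
  have le: "K1 \<le> K" "K2 \<le> K" "K3 \<le> K" "K4 \<le> K" "0 < K"
    using K1(1) K2(1) K3(1) K4(1) by (simp_all add: K_def)
  show ?thesis
  proof (rule exI[of _ "exp (- K)"], rule exI[of _ "exp K"], fold near_def, intro conjI allI impI)
    show "0 < exp (- K)" "exp (- K) < exp K"
      using le by simp_all
    fix n :: nat assume n: "1 \<le> n"
    show "near K \<bar>u_traj (n div 2) n - 1\<bar> (- real n / 2)"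
      using near_mono[OF K1(2)[OF n]] le by simp
    show "near K \<bar>p_traj 0 n - p_star 0\<bar> (- real n)"
      using near_mono[of K3 "\<bar>p_traj 0 n - p_star 0\<bar>" "- real n" K] K3(2)[OF n, of 0] le by simp
    show "near K (C_lim - C_const n) (- real n)"
      using near_mono[OF K4(2)[OF n]] le by simp
    fix j :: nat assume "real j \<le> real n / 2"
    then have j: "j \<le> n div 2" by linarith
    show "near K (\<bar>p_traj j n - 1\<bar> + \<bar>u_traj j n - 1\<bar>) (- real j)"
      using near_mono[OF K2(2)[OF n j]] le by simp
    show "near K (\<bar>p_traj j n - p_star j\<bar> + \<bar>u_traj j n - u_star j\<bar>) (real j - real n)"
      using near_mono[of K3 _ _ K] K3(2)[OF n j] le by simp
  qed
qed

end
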